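(* In any differential category, with $\mathsf{K}$, $\mathsf{J}$ and $\mathsf{J}_n$ ($n\in\mathbb{N}$) the natural transformations $!\Rightarrow{}!$ defined from the deriving and coderiving transformations by $\mathsf{K}=\mathsf{d}^\circ\mathsf{d}+{!}(0)$, $\mathsf{J}=\mathsf{d}^\circ\mathsf{d}+1$, $\mathsf{J}_n=\mathsf{J}+n\cdot 1$: (i) if $\mathsf{K}$ is a natural isomorphism then $\mathsf{J}$ is a natural isomorphism; (ii) if $\mathsf{J}_n$ is a natural isomorphism then $\mathsf{J}_m$ is a natural isomorphism for every $m\ge n$; (iii) if $\mathsf{J}$ is a natural isomorphism and the deriving transformation $\mathsf{d}$ is Taylor, then $\mathsf{K}$ is a natural isomorphism.
   Context: Conventions. Composition is in diagrammatic order: $fg$ means first $f$, then $g$. Symmetric monoidal categories are treated as strict; $\otimes$ is the tensor, $I$ the unit, $\sigma$ the symmetry, $1$ an identity map. An additive category is a category enriched in commutative monoids (no negatives or biproducts assumed): hom-sets have $+$ and $0$ with $k(f+g)h=kfh+kgh$, $0f=0$, $f0=0$. An additive symmetric monoidal category is a symmetric monoidal category that is additive with $k\otimes(f+g)\otimes h=k\otimes f\otimes h+k\otimes g\otimes h$, $0\otimes h=0$, $h\otimes 0=0$. For $n\in\mathbb{N}$, $n\cdot f$ is the $n$-fold sum of $f$. A coalgebra modality $(!,\delta,\varepsilon,\Delta,e)$ is a comonad $(!,\delta,\varepsilon)$ with natural transformations $\Delta_A:{!}A\to{!}A\otimes{!}A$ and $e_A:{!}A\to I$ such that each $({!}A,\Delta_A,e_A)$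 is a cocommutative comonoid and $\delta\Delta=\Delta(\delta\otimes\delta)$. ($!$ is not assumed to preserve addition or zero.) The coderiving transformation is $\mathsf{d}^\circ_A=\Delta_A(1_{!A}\otimes\varepsilon_A):{!}A\to{!}A\otimes A$. A differential category is an additive symmetric monoidal category with a coalgebra modality and a deriving transformation: a natural transformation $\mathsf{d}_A:{!}A\otimes A\to{!}A$ such that [d.1] $\mathsf{d}e=0$; [d.2] $\mathsf{d}\Delta=(\Delta\otimes1)(1\otimes\sigma)(\mathsf{d}\otimes1)+(\Delta\otimes1)(1\otimes\mathsf{d})$; [d.3] $\mathsf{d}\varepsilon=e\otimes1$; [d.4] $\mathsf{d}\delta=(\Delta\otimes1)(\delta\otimes1\otimes1)(1\otimes\mathsf{d})\mathsf{d}$; [d.5] $(\mathsf{d}\otimes1)\mathsf{d}=(1\otimes\sigma)(\mathsf{d}\otimes1)\mathsf{d}$. $\mathsf{d}$ is Taylor if for all objects $A,B,C$ and all $f,g:C\otimes{!}A\to B$ with $(1\otimes\mathsf{d})f=(1\otimes\mathsf{d})g$ one has $f+(1\otimes{!}(0))g=g+(1\otimes{!}(0))f$, where $!(0):{!}A\to{!}A$ is $!$ applied to the zero map $0:A\to A$. *)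

theory Defs
  imports "HOL-Algebra.Group"
begin

text \<open>
  Categories are given by a set of objects and a set of arrows with domain and codomain maps.
  The operations are total HOL functions and are constrained only on objects, respectively on
  suitably composable or parallel arrows. Composition is in diagrammatic order:
  \<open>f \<Zcomp> g\<close> is first \<open>f\<close>, then \<open>g\<close>. Monoidal structure is strict.
\<close>

section \<open>Categories, functors and natural transformations\<close>

record ('o, 'a) category =
  Obj :: "'o set"
  Arr :: "'a set"
  Dom :: "'a \<Rightarrow> 'o"
  Cod :: "'a \<Rightarrow> 'o"
  Id :: "'o \<Rightarrow> 'a"  (\<open>\<^bold>1\<index>\<close>)
  Comp :: "'a \<Rightarrow> 'a \<Rightarrow> 'a"  (infixl \<open>\<Zcomp>\<index>\<close> 70)

definition Hom :: "('o, 'a, 'm) category_scheme \<Rightarrow> 'o \<Rightarrow> 'o \<Rightarrow> 'a set" where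
  "Hom C A B = {f \<in> Arr C. Dom C f = A \<and> Cod C f = B}"

locale category =
  fixes C :: "('o, 'a, 'm) category_scheme" (structure)
  assumes Dom_closed: "f \<in> Arr C \<Longrightarrow> Dom C f \<in> Obj C"
    and Cod_closed: "f \<in> Arr C \<Longrightarrow> Cod C f \<in> Obj C"
    and Id_closed: "A \<in> Obj C \<Longrightarrow> \<^bold>1 A \<in> Hom C A A"
    and Comp_closed: "\<lbrakk>f \<in> Hom C A B; g \<in> Hom C B D\<rbrakk> \<Longrightarrow> f \<Zcomp> g \<in> Hom C A D"
    and Id_left: "f \<in> Hom C A B \<Longrightarrow> \<^bold>1 A \<Zcomp> f = f"
    and Id_right: "f \<in> Hom C A B \<Longrightarrow> f \<Zcomp> \<^bold>1 B = f"
    and Comp_assoc: "\<lbrakk>f \<in> Hom C A B; g \<in> Hom C B D; h \<in> Hom C D E\<rbrakk>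
      \<Longrightarrow> (f \<Zcomp> g) \<Zcomp> h = f \<Zcomp> (g \<Zcomp> h)"

definition endofunctor ::
  "('o, 'a, 'm) category_scheme \<Rightarrow> ('o \<Rightarrow> 'o) \<Rightarrow> ('a \<Rightarrow> 'a) \<Rightarrow> bool" where
  "endofunctor C F\<^sub>o F\<^sub>a \<longleftrightarrow>
     (\<forall>A \<in> Obj C. F\<^sub>o A \<in> Obj C) \<and>
     (\<forall>f \<in> Arr C. F\<^sub>a f \<in> Hom C (F\<^sub>o (Dom C f)) (F\<^sub>o (Cod C f))) \<and>
     (\<forall>A \<in> Obj C. F\<^sub>a (Id C A) = Id C (F\<^sub>o A)) \<and>
     (\<forall>f \<in> Arr C. \<forall>g \<in> Arr C. Cod C f = Dom C g \<longrightarrow>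
        F\<^sub>a (Comp C f g) = Comp C (F\<^sub>a f) (F\<^sub>a g))"

definition natural_transformation ::
  "('o, 'a, 'm) category_scheme \<Rightarrow> ('o \<Rightarrow> 'o) \<Rightarrow> ('a \<Rightarrow> 'a) \<Rightarrow> ('o \<Rightarrow> 'o) \<Rightarrow> ('a \<Rightarrow> 'a)
     \<Rightarrow> ('o \<Rightarrow> 'a) \<Rightarrow> bool" where
  "natural_transformation C F\<^sub>o F\<^sub>a G\<^sub>o G\<^sub>a t \<longleftrightarrow>
     (\<forall>A \<in> Obj C. t A \<in> Hom C (F\<^sub>o A) (G\<^sub>o A)) \<and>
     (\<forall>f \<in> Arr C. Comp C (F\<^sub>a f) (t (Cod C f)) = Comp C (t (Dom C f)) (G\<^sub>a f))"

definition isomorphism :: "('o, 'a, 'm) category_scheme \<Rightarrow> 'a \<Rightarrow> bool" where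
  "isomorphism C f \<longleftrightarrow> f \<in> Arr C \<and>
     (\<exists>g \<in> Hom C (Cod C f) (Dom C f).
        Comp C f g = Id C (Dom C f) \<and> Comp C g f = Id C (Cod C f))"

definition natural_isomorphism ::
  "('o, 'a, 'm) category_scheme \<Rightarrow> ('o \<Rightarrow> 'o) \<Rightarrow> ('a \<Rightarrow> 'a) \<Rightarrow> ('o \<Rightarrow> 'o) \<Rightarrow> ('a \<Rightarrow> 'a)
     \<Rightarrow> ('o \<Rightarrow> 'a) \<Rightarrow> bool" where
  "natural_isomorphism C F\<^sub>o F\<^sub>a G\<^sub>o G\<^sub>a t \<longleftrightarrow>
     natural_transformation C F\<^sub>o F\<^sub>a G\<^sub>o G\<^sub>a t \<and> (\<forall>A \<in> Obj C. isomorphism C (t A))"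

section \<open>Additive symmetric monoidal categories\<close>

record ('o, 'a) sm_category = "('o, 'a) category" +
  Unit :: 'o  (\<open>\<^bold>I\<index>\<close>)
  TensorO :: "'o \<Rightarrow> 'o \<Rightarrow> 'o"  (infixl \<open>\<otimes>\<^sub>o\<index>\<close> 75)
  TensorA :: "'a \<Rightarrow> 'a \<Rightarrow> 'a"  (infixl \<open>\<otimes>\<^sub>a\<index>\<close> 75)
  Sym :: "'o \<Rightarrow> 'o \<Rightarrow> 'a"  (\<open>\<^bold>\<sigma>\<index>\<close>)

text \<open>
  The unit law \<open>\<^bold>\<sigma> A \<^bold>I = \<^bold>1 A\<close> of a symmetry is not listed: it follows from
  \<open>Sym_hexagon\<close> with both other objects equal to \<open>\<^bold>I\<close>, since \<open>\<^bold>\<sigma> A \<^bold>I\<close> is invertible.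
\<close>

locale symmetric_monoidal_category = category C
  for C :: "('o, 'a, 'm) sm_category_scheme" (structure) +
  assumes Unit_closed: "\<^bold>I \<in> Obj C"
    and TensorO_closed: "\<lbrakk>A \<in> Obj C; B \<in> Obj C\<rbrakk> \<Longrightarrow> A \<otimes>\<^sub>o B \<in> Obj C"
    and TensorA_closed: "\<lbrakk>f \<in> Hom C A B; g \<in> Hom C A' B'\<rbrakk>
      \<Longrightarrow> f \<otimes>\<^sub>a g \<in> Hom C (A \<otimes>\<^sub>o A') (B \<otimes>\<^sub>o B')"
    and Tensor_Id: "\<lbrakk>A \<in> Obj C; B \<in> Obj C\<rbrakk> \<Longrightarrow> \<^bold>1 A \<otimes>\<^sub>a \<^bold>1 B = \<^bold>1 (A \<otimes>\<^sub>o B)"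
    and Tensor_Comp: "\<lbrakk>f \<in> Hom C A B; g \<in> Hom C B D; f' \<in> Hom C A' B'; g' \<in> Hom C B' D'\<rbrakk>
      \<Longrightarrow> (f \<Zcomp> g) \<otimes>\<^sub>a (f' \<Zcomp> g') = (f \<otimes>\<^sub>a f') \<Zcomp> (g \<otimes>\<^sub>a g')"
    and TensorO_assoc: "\<lbrakk>A \<in> Obj C; B \<in> Obj C; D \<in> Obj C\<rbrakk>
      \<Longrightarrow> (A \<otimes>\<^sub>o B) \<otimes>\<^sub>o D = A \<otimes>\<^sub>o (B \<otimes>\<^sub>o D)"
    and TensorA_assoc: "\<lbrakk>f \<in> Arr C; g \<in> Arr C; h \<in> Arr C\<rbrakk>
      \<Longrightarrow> (f \<otimes>\<^sub>a g) \<otimes>\<^sub>a h = f \<otimes>\<^sub>a (g \<otimes>\<^sub>a h)"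
    and TensorO_unit_left: "A \<in> Obj C \<Longrightarrow> \<^bold>I \<otimes>\<^sub>o A = A"
    and TensorO_unit_right: "A \<in> Obj C \<Longrightarrow> A \<otimes>\<^sub>o \<^bold>I = A"
    and TensorA_unit_left: "f \<in> Arr C \<Longrightarrow> \<^bold>1 \<^bold>I \<otimes>\<^sub>a f = f"
    and TensorA_unit_right: "f \<in> Arr C \<Longrightarrow> f \<otimes>\<^sub>a \<^bold>1 \<^bold>I = f"
    and Sym_closed: "\<lbrakk>A \<in> Obj C; B \<in> Obj C\<rbrakk> \<Longrightarrow> \<^bold>\<sigma> A B \<in> Hom C (A \<otimes>\<^sub>o B) (B \<otimes>\<^sub>o A)"
    and Sym_natural: "\<lbrakk>f \<in> Hom C A B; f' \<in> Hom C A' B'\<rbrakk>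
      \<Longrightarrow> (f \<otimes>\<^sub>a f') \<Zcomp> \<^bold>\<sigma> B B' = \<^bold>\<sigma> A A' \<Zcomp> (f' \<otimes>\<^sub>a f)"
    and Sym_involutive: "\<lbrakk>A \<in> Obj C; B \<in> Obj C\<rbrakk> \<Longrightarrow> \<^bold>\<sigma> A B \<Zcomp> \<^bold>\<sigma> B A = \<^bold>1 (A \<otimes>\<^sub>o B)"
    and Sym_hexagon: "\<lbrakk>A \<in> Obj C; B \<in> Obj C; D \<in> Obj C\<rbrakk>
      \<Longrightarrow> \<^bold>\<sigma> A (B \<otimes>\<^sub>o D) = (\<^bold>\<sigma> A B \<otimes>\<^sub>a \<^bold>1 D) \<Zcomp> (\<^bold>1 B \<otimes>\<^sub>a \<^bold>\<sigma> A D)"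

record ('o, 'a) asm_category = "('o, 'a) sm_category" +
  Zero :: "'o \<Rightarrow> 'o \<Rightarrow> 'a"  (\<open>\<^bold>0\<index>\<close>)
  Add :: "'a \<Rightarrow> 'a \<Rightarrow> 'a"  (infixl \<open>\<^bold>+\<index>\<close> 65)

text \<open>
  The hom-set from \<open>A\<close> to \<open>B\<close> with its addition, in the (multiplicatively written) format of
  \<open>HOL-Algebra\<close>; the \<open>n\<close>-fold sum \<open>n \<cdot> f\<close> is the power \<open>f [^] n\<close> in this monoid.
\<close>

definition hom_monoid :: "('o, 'a, 'm) asm_category_scheme \<Rightarrow> 'o \<Rightarrow> 'o \<Rightarrow> 'a monoid" where
  "hom_monoid C A B = \<lparr>carrier = Hom C A B, monoid.mult = Add C, one = Zero C A B\<rparr>"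

locale additive_symmetric_monoidal_category = symmetric_monoidal_category C
  for C :: "('o, 'a, 'm) asm_category_scheme" (structure) +
  assumes Hom_comm_monoid: "\<lbrakk>A \<in> Obj C; B \<in> Obj C\<rbrakk> \<Longrightarrow> comm_monoid (hom_monoid C A B)"
    and Comp_Add: "\<lbrakk>k \<in> Hom C A A'; f \<in> Hom C A' B'; g \<in> Hom C A' B'; h \<in> Hom C B' B\<rbrakk>
      \<Longrightarrow> k \<Zcomp> (f \<^bold>+ g) \<Zcomp> h = k \<Zcomp> f \<Zcomp> h \<^bold>+ k \<Zcomp> g \<Zcomp> h"
    and Zero_Comp: "\<lbrakk>A \<in> Obj C; f \<in> Hom C B D\<rbrakk> \<Longrightarrow> \<^bold>0 A B \<Zcomp> f = \<^bold>0 A D"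
    and Comp_Zero: "\<lbrakk>f \<in> Hom C A B; D \<in> Obj C\<rbrakk> \<Longrightarrow> f \<Zcomp> \<^bold>0 B D = \<^bold>0 A D"
    and Tensor_Add: "\<lbrakk>k \<in> Arr C; f \<in> Hom C A B; g \<in> Hom C A B; h \<in> Arr C\<rbrakk>
      \<Longrightarrow> k \<otimes>\<^sub>a (f \<^bold>+ g) \<otimes>\<^sub>a h = k \<otimes>\<^sub>a f \<otimes>\<^sub>a h \<^bold>+ k \<otimes>\<^sub>a g \<otimes>\<^sub>a h"
    and Zero_Tensor: "\<lbrakk>A \<in> Obj C; B \<in> Obj C; h \<in> Hom C A' B'\<rbrakk>
      \<Longrightarrow> \<^bold>0 A B \<otimes>\<^sub>a h = \<^bold>0 (A \<otimes>\<^sub>o A') (B \<otimes>\<^sub>o B')"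
    and Tensor_Zero: "\<lbrakk>A \<in> Obj C; B \<in> Obj C; h \<in> Hom C A' B'\<rbrakk>
      \<Longrightarrow> h \<otimes>\<^sub>a \<^bold>0 A B = \<^bold>0 (A' \<otimes>\<^sub>o A) (B' \<otimes>\<^sub>o B)"

section \<open>Coalgebra modalities and differential categories\<close>

record ('o, 'a) coalg_category = "('o, 'a) asm_category" +
  BangO :: "'o \<Rightarrow> 'o"  (\<open>\<^bold>!\<^sub>o\<index>\<close>)
  BangA :: "'a \<Rightarrow> 'a"  (\<open>\<^bold>!\<^sub>a\<index>\<close>)
  CDelta :: "'o \<Rightarrow> 'a"  (\<open>\<^bold>\<delta>\<index>\<close>)
  CEps :: "'o \<Rightarrow> 'a"  (\<open>\<^bold>\<epsilon>\<index>\<close>)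
  Copy :: "'o \<Rightarrow> 'a"  (\<open>\<^bold>\<Delta>\<index>\<close>)
  Discard :: "'o \<Rightarrow> 'a"  (\<open>\<^bold>e\<index>\<close>)

locale coalgebra_modality = additive_symmetric_monoidal_category C
  for C :: "('o, 'a, 'm) coalg_category_scheme" (structure) +
  assumes Bang_functor: "endofunctor C \<^bold>!\<^sub>o \<^bold>!\<^sub>a"
    and CDelta_natural: "natural_transformation C
      \<^bold>!\<^sub>o \<^bold>!\<^sub>a (\<lambda>A. \<^bold>!\<^sub>o (\<^bold>!\<^sub>o A)) (\<lambda>f. \<^bold>!\<^sub>a (\<^bold>!\<^sub>a f)) \<^bold>\<delta>"
    and CEps_natural: "natural_transformation C \<^bold>!\<^sub>o \<^bold>!\<^sub>a (\<lambda>A. A) (\<lambda>f. f) \<^bold>\<epsilon>"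
    and comonad_counit_left: "A \<in> Obj C \<Longrightarrow> \<^bold>\<delta> A \<Zcomp> \<^bold>\<epsilon> (\<^bold>!\<^sub>o A) = \<^bold>1 (\<^bold>!\<^sub>o A)"
    and comonad_counit_right: "A \<in> Obj C \<Longrightarrow> \<^bold>\<delta> A \<Zcomp> \<^bold>!\<^sub>a (\<^bold>\<epsilon> A) = \<^bold>1 (\<^bold>!\<^sub>o A)"
    and comonad_coassoc: "A \<in> Obj C \<Longrightarrow> \<^bold>\<delta> A \<Zcomp> \<^bold>\<delta> (\<^bold>!\<^sub>o A) = \<^bold>\<delta> A \<Zcomp> \<^bold>!\<^sub>a (\<^bold>\<delta> A)"
    and Copy_natural: "natural_transformation C
      \<^bold>!\<^sub>o \<^bold>!\<^sub>a (\<lambda>A. \<^bold>!\<^sub>o A \<otimes>\<^sub>o \<^bold>!\<^sub>o A) (\<lambda>f. \<^bold>!\<^sub>a f \<otimes>\<^sub>a \<^bold>!\<^sub>a f) \<^bold>\<Delta>"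
    and Discard_natural: "natural_transformation C
      \<^bold>!\<^sub>o \<^bold>!\<^sub>a (\<lambda>A. \<^bold>I) (\<lambda>f. \<^bold>1 \<^bold>I) \<^bold>e"
    and Copy_coassoc: "A \<in> Obj C
      \<Longrightarrow> \<^bold>\<Delta> A \<Zcomp> (\<^bold>\<Delta> A \<otimes>\<^sub>a \<^bold>1 (\<^bold>!\<^sub>o A)) = \<^bold>\<Delta> A \<Zcomp> (\<^bold>1 (\<^bold>!\<^sub>o A) \<otimes>\<^sub>a \<^bold>\<Delta> A)"
    and Copy_counit_left: "A \<in> Obj C \<Longrightarrow> \<^bold>\<Delta> A \<Zcomp> (\<^bold>e A \<otimes>\<^sub>a \<^bold>1 (\<^bold>!\<^sub>o A)) = \<^bold>1 (\<^bold>!\<^sub>o A)"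
    and Copy_counit_right: "A \<in> Obj C \<Longrightarrow> \<^bold>\<Delta> A \<Zcomp> (\<^bold>1 (\<^bold>!\<^sub>o A) \<otimes>\<^sub>a \<^bold>e A) = \<^bold>1 (\<^bold>!\<^sub>o A)"
    and Copy_cocommutative: "A \<in> Obj C \<Longrightarrow> \<^bold>\<Delta> A \<Zcomp> \<^bold>\<sigma> (\<^bold>!\<^sub>o A) (\<^bold>!\<^sub>o A) = \<^bold>\<Delta> A"
    and CDelta_Copy: "A \<in> Obj C \<Longrightarrow> \<^bold>\<delta> A \<Zcomp> \<^bold>\<Delta> (\<^bold>!\<^sub>o A) = \<^bold>\<Delta> A \<Zcomp> (\<^bold>\<delta> A \<otimes>\<^sub>a \<^bold>\<delta> A)"

record ('o, 'a) diff_category = "('o, 'a) coalg_category" +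
  Deriv :: "'o \<Rightarrow> 'a"  (\<open>\<^bold>d\<index>\<close>)

locale differential_category = coalgebra_modality C
  for C :: "('o, 'a, 'm) diff_category_scheme" (structure) +
  assumes Deriv_natural: "natural_transformation C
      (\<lambda>A. \<^bold>!\<^sub>o A \<otimes>\<^sub>o A) (\<lambda>f. \<^bold>!\<^sub>a f \<otimes>\<^sub>a f) \<^bold>!\<^sub>o \<^bold>!\<^sub>a \<^bold>d"
    and d1: "A \<in> Obj C \<Longrightarrow> \<^bold>d A \<Zcomp> \<^bold>e A = \<^bold>0 (\<^bold>!\<^sub>o A \<otimes>\<^sub>o A) \<^bold>I"
    and d2: "A \<in> Obj C \<Longrightarrow> \<^bold>d A \<Zcomp> \<^bold>\<Delta> A =
        (\<^bold>\<Delta> A \<otimes>\<^sub>a \<^bold>1 A) \<Zcomp> (\<^bold>1 (\<^bold>!\<^sub>o A) \<otimes>\<^sub>a \<^bold>\<sigma> (\<^bold>!\<^sub>o A) A) \<Zcomp> (\<^bold>d A \<otimes>\<^sub>a \<^bold>1 (\<^bold>!\<^sub>o A))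
        \<^bold>+ (\<^bold>\<Delta> A \<otimes>\<^sub>a \<^bold>1 A) \<Zcomp> (\<^bold>1 (\<^bold>!\<^sub>o A) \<otimes>\<^sub>a \<^bold>d A)"
    and d3: "A \<in> Obj C \<Longrightarrow> \<^bold>d A \<Zcomp> \<^bold>\<epsilon> A = \<^bold>e A \<otimes>\<^sub>a \<^bold>1 A"
    and d4: "A \<in> Obj C \<Longrightarrow> \<^bold>d A \<Zcomp> \<^bold>\<delta> A =
        (\<^bold>\<Delta> A \<otimes>\<^sub>a \<^bold>1 A) \<Zcomp> (\<^bold>\<delta> A \<otimes>\<^sub>a \<^bold>1 (\<^bold>!\<^sub>o A) \<otimes>\<^sub>a \<^bold>1 A)
        \<Zcomp> (\<^bold>1 (\<^bold>!\<^sub>o (\<^bold>!\<^sub>o A)) \<otimes>\<^sub>a \<^bold>d A) \<Zcomp> \<^bold>d (\<^bold>!\<^sub>o A)"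
    and d5: "A \<in> Obj C \<Longrightarrow> (\<^bold>d A \<otimes>\<^sub>a \<^bold>1 A) \<Zcomp> \<^bold>d A =
        (\<^bold>1 (\<^bold>!\<^sub>o A) \<otimes>\<^sub>a \<^bold>\<sigma> A A) \<Zcomp> (\<^bold>d A \<otimes>\<^sub>a \<^bold>1 A) \<Zcomp> \<^bold>d A"

definition coderiving :: "('o, 'a, 'm) coalg_category_scheme \<Rightarrow> 'o \<Rightarrow> 'a"  (\<open>\<^bold>d\<degree>\<index>\<close>) where
  "\<^bold>d\<degree>\<^bsub>C\<^esub> A = \<^bold>\<Delta>\<^bsub>C\<^esub> A \<Zcomp>\<^bsub>C\<^esub> (\<^bold>1\<^bsub>C\<^esub> (\<^bold>!\<^sub>o\<^bsub>C\<^esub> A) \<otimes>\<^sub>a\<^bsub>C\<^esub> \<^bold>\<epsilon>\<^bsub>C\<^esub> A)"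

definition Taylor :: "('o, 'a, 'm) diff_category_scheme \<Rightarrow> bool" where
  "Taylor C \<longleftrightarrow> (\<forall>A \<in> Obj C. \<forall>B \<in> Obj C. \<forall>D \<in> Obj C.
     \<forall>f \<in> Hom C (D \<otimes>\<^sub>o\<^bsub>C\<^esub> \<^bold>!\<^sub>o\<^bsub>C\<^esub> A) B. \<forall>g \<in> Hom C (D \<otimes>\<^sub>o\<^bsub>C\<^esub> \<^bold>!\<^sub>o\<^bsub>C\<^esub> A) B.
       (\<^bold>1\<^bsub>C\<^esub> D \<otimes>\<^sub>a\<^bsub>C\<^esub> \<^bold>d\<^bsub>C\<^esub> A) \<Zcomp>\<^bsub>C\<^esub> f = (\<^bold>1\<^bsub>C\<^esub> D \<otimes>\<^sub>a\<^bsub>C\<^esub> \<^bold>d\<^bsub>C\<^esub> A) \<Zcomp>\<^bsub>C\<^esub> g \<longrightarrow>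
       f \<^bold>+\<^bsub>C\<^esub> (\<^bold>1\<^bsub>C\<^esub> D \<otimes>\<^sub>a\<^bsub>C\<^esub> \<^bold>!\<^sub>a\<^bsub>C\<^esub> (\<^bold>0\<^bsub>C\<^esub> A A)) \<Zcomp>\<^bsub>C\<^esub> g =
       g \<^bold>+\<^bsub>C\<^esub> (\<^bold>1\<^bsub>C\<^esub> D \<otimes>\<^sub>a\<^bsub>C\<^esub> \<^bold>!\<^sub>a\<^bsub>C\<^esub> (\<^bold>0\<^bsub>C\<^esub> A A)) \<Zcomp>\<^bsub>C\<^esub> f)"

definition K :: "('o, 'a, 'm) diff_category_scheme \<Rightarrow> 'o \<Rightarrow> 'a" where
  "K C A = \<^bold>d\<degree>\<^bsub>C\<^esub> A \<Zcomp>\<^bsub>C\<^esub> \<^bold>d\<^bsub>C\<^esub> A \<^bold>+\<^bsub>C\<^esub> \<^bold>!\<^sub>a\<^bsub>C\<^esub> (\<^bold>0\<^bsub>C\<^esub> A A)"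

definition J :: "('o, 'a, 'm) diff_category_scheme \<Rightarrow> 'o \<Rightarrow> 'a" where
  "J C A = \<^bold>d\<degree>\<^bsub>C\<^esub> A \<Zcomp>\<^bsub>C\<^esub> \<^bold>d\<^bsub>C\<^esub> A \<^bold>+\<^bsub>C\<^esub> \<^bold>1\<^bsub>C\<^esub> (\<^bold>!\<^sub>o\<^bsub>C\<^esub> A)"

definition Jn :: "('o, 'a, 'm) diff_category_scheme \<Rightarrow> nat \<Rightarrow> 'o \<Rightarrow> 'a" where
  "Jn C n A = J C A \<^bold>+\<^bsub>C\<^esub>
     \<^bold>1\<^bsub>C\<^esub> (\<^bold>!\<^sub>o\<^bsub>C\<^esub> A) [^]\<^bsub>hom_monoid C (\<^bold>!\<^sub>o\<^bsub>C\<^esub> A) (\<^bold>!\<^sub>o\<^bsub>C\<^esub> A)\<^esub> n"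

abbreviation bang_natural_isomorphism ::
  "('o, 'a, 'm) coalg_category_scheme \<Rightarrow> ('o \<Rightarrow> 'a) \<Rightarrow> bool" where
  "bang_natural_isomorphism C \<equiv> natural_isomorphism C (BangO C) (BangA C) (BangO C) (BangA C)"

end

theory Submission
  imports Defs
begin

text \<open>
  The map \<open>W = d\<degree> d\<close> multiplies by the degree: on a \<open>k\<close>-homogeneous map out of \<open>!A\<close>, the maps
  \<open>K\<close>, \<open>J\<close> and \<open>J\<^sub>n\<close> multiply by \<open>k\<close> (by \<open>1\<close> if \<open>k = 0\<close>), \<open>k + 1\<close> and \<open>k + 1 + n\<close>.
  Multiplying by a formal variable raises the degree by one, so dividing by the degree there and
  then erasing the variable divides by \<open>k + 1\<close>. In terms of arrows, the inverse of \<open>J\<close> at \<open>A\<close> is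
  \<open>\<delta> K\<inverse> \<phi>\<close>, where \<open>K\<close> is taken at \<open>!A\<close> and \<open>\<phi> = d\<degree> (!(\<epsilon>) \<otimes> e)\<close> (\<open>shift\<close>); the same formula with
  \<open>J\<^sub>n\<close> in place of \<open>K\<close> inverts \<open>J\<^sub>n\<^sub>+\<^sub>1\<close>. The key identities are \<open>K \<phi> = \<phi> J\<close>, \<open>\<delta> \<phi> = 1\<close> and
  \<open>J \<delta> = \<delta> (E + 1)\<close>, where \<open>E\<close> (\<open>inner_W\<close>) is the degree in \<open>A\<close> seen on \<open>!!A\<close>: it commutes with \<open>K\<close> and
  satisfies \<open>(E + 1) \<phi> = \<phi> J\<close>.

  In the converse direction, \<open>J\<close> and \<open>J\<^sub>1\<close> are invertible and \<open>f = d\<degree> (J\<inverse> \<otimes> 1) d\<close> satisfies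
  \<open>d f = d\<close>, so the Taylor property gives \<open>f + !(0) = 1\<close>. Hence \<open>d\<degree> (J\<inverse> J\<inverse> \<otimes> 1) d + !(0)\<close> is
  inverse to \<open>K\<close>.
\<close>

section \<open>Typing and rewriting of arrows in strict additive symmetric monoidal
  categories\<close>

context category
begin

lemma Hom_Arr: "f \<in> Arr C \<Longrightarrow> f \<in> Hom C (Dom C f) (Cod C f)"
  by (simp add: Hom_def)

lemma HomD:
  assumes "f \<in> Hom C A B"
  shows "f \<in> Arr C" "Dom C f = A" "Cod C f = B"
  using assms by (auto simp: Hom_def)

lemma arr_Id [simp]:
  assumes "A \<in> Obj C"
  shows "\<^bold>1 A \<in> Arr C" "Dom C (\<^bold>1 A) = A" "Cod C (\<^bold>1 A) = A"
  using HomD[OF Id_closed[OF assms]] .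

lemma arr_Comp [simp]:
  assumes "f \<in> Arr C" "g \<in> Arr C" "Cod C f = Dom C g"
  shows "f \<Zcomp> g \<in> Arr C" "Dom C (f \<Zcomp> g) = Dom C f" "Cod C (f \<Zcomp> g) = Cod C g"
  using HomD[OF Comp_closed, of f "Dom C f" "Cod C f" g "Cod C g"] assms by (auto simp: Hom_def)

lemma Comp_Id_left [simp]: "f \<in> Arr C \<Longrightarrow> A = Dom C f \<Longrightarrow> \<^bold>1 A \<Zcomp> f = f"
  using Id_left Hom_Arr by blast

lemma Comp_Id_right [simp]: "f \<in> Arr C \<Longrightarrow> A = Cod C f \<Longrightarrow> f \<Zcomp> \<^bold>1 A = f"
  using Id_right Hom_Arr by blast

lemma Comp_assoc_arr [simp]:
  "\<lbrakk>f \<in> Arr C; g \<in> Arr C; h \<in> Arr C; Cod C f = Dom C g; Cod C g = Dom C h\<rbrakk>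
    \<Longrightarrow> (f \<Zcomp> g) \<Zcomp> h = f \<Zcomp> (g \<Zcomp> h)"
  by (rule Comp_assoc) (auto simp: Hom_def)

text \<open>Composites are kept bracketed to the right, so an equation for
  \<open>f \<Zcomp> g\<close> does not match inside a longer composite; this form applies it to the
  first two factors.\<close>

lemma Comp_extend:
  assumes "f \<Zcomp> g = h" "f \<in> Arr C" "g \<in> Arr C" "k \<in> Arr C"
    "Cod C f = Dom C g" "Cod C g = Dom C k"
  shows "f \<Zcomp> (g \<Zcomp> k) = h \<Zcomp> k"
  using assms Comp_assoc_arr by metis

lemmas [simp] = Dom_closed Cod_closed

end

context symmetric_monoidal_category
begin

lemmas [simp] = Unit_closed TensorO_closed TensorO_assoc TensorA_assoc
  TensorO_unit_left TensorO_unit_right TensorA_unit_left TensorA_unit_right Tensor_Id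

lemma arr_Tensor [simp]:
  assumes "f \<in> Arr C" "g \<in> Arr C"
  shows "f \<otimes>\<^sub>a g \<in> Arr C"
    "Dom C (f \<otimes>\<^sub>a g) = Dom C f \<otimes>\<^sub>o Dom C g" "Cod C (f \<otimes>\<^sub>a g) = Cod C f \<otimes>\<^sub>o Cod C g"
  using HomD[OF TensorA_closed[OF Hom_Arr Hom_Arr]] assms by auto

lemma arr_Sym [simp]:
  assumes "A \<in> Obj C" "B \<in> Obj C"
  shows "\<^bold>\<sigma> A B \<in> Arr C" "Dom C (\<^bold>\<sigma> A B) = A \<otimes>\<^sub>o B" "Cod C (\<^bold>\<sigma> A B) = B \<otimes>\<^sub>o A"
  using HomD[OF Sym_closed[OF assms]] .

text \<open>Oriented so that a composite of tensors merges into one tensor, whose factors can then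
  be rewritten separately.\<close>

lemma interchange:
  "\<lbrakk>f \<in> Arr C; g \<in> Arr C; f' \<in> Arr C; g' \<in> Arr C; Cod C f = Dom C g; Cod C f' = Dom C g'\<rbrakk>
    \<Longrightarrow> (f \<otimes>\<^sub>a f') \<Zcomp> (g \<otimes>\<^sub>a g') = (f \<Zcomp> g) \<otimes>\<^sub>a (f' \<Zcomp> g')"
  by (rule Tensor_Comp[symmetric]) (auto simp: Hom_def)

lemma Sym_slide:
  "\<lbrakk>f \<in> Arr C; g \<in> Arr C; A = Cod C f; B = Cod C g\<rbrakk>
    \<Longrightarrow> (f \<otimes>\<^sub>a g) \<Zcomp> \<^bold>\<sigma> A B = \<^bold>\<sigma> (Dom C f) (Dom C g) \<Zcomp> (g \<otimes>\<^sub>a f)"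
  by (auto intro: Sym_natural simp: Hom_def)

end

context additive_symmetric_monoidal_category
begin

lemma arr_Add [simp]:
  assumes "f \<in> Arr C" "g \<in> Arr C" "Dom C f = Dom C g" "Cod C f = Cod C g"
  shows "f \<^bold>+ g \<in> Arr C" "Dom C (f \<^bold>+ g) = Dom C g" "Cod C (f \<^bold>+ g) = Cod C g"
proof -
  interpret comm_monoid "hom_monoid C (Dom C g) (Cod C g)"
    using assms by (simp add: Hom_comm_monoid)
  have "f \<^bold>+ g \<in> Hom C (Dom C g) (Cod C g)"
    using m_closed[of f g] assms by (simp add: hom_monoid_def Hom_def)
  then show "f \<^bold>+ g \<in> Arr C" "Dom C (f \<^bold>+ g) = Dom C g" "Cod C (f \<^bold>+ g) = Cod C g"
    by (simp_all add: Hom_def)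
qed

lemma arr_Zero [simp]:
  assumes "A \<in> Obj C" "B \<in> Obj C"
  shows "\<^bold>0 A B \<in> Arr C" "Dom C (\<^bold>0 A B) = A" "Cod C (\<^bold>0 A B) = B"
  using monoid.one_closed[OF comm_monoid.axioms(1)[OF Hom_comm_monoid[OF assms]]]
  by (auto simp: hom_monoid_def Hom_def)

lemma Add_assoc:
  assumes "f \<in> Arr C" "g \<in> Arr C" "h \<in> Arr C" "Dom C f = Dom C g" "Cod C f = Cod C g"
    "Dom C g = Dom C h" "Cod C g = Cod C h"
  shows "f \<^bold>+ g \<^bold>+ h = f \<^bold>+ (g \<^bold>+ h)"
  using monoid.m_assoc[OF comm_monoid.axioms(1)[OF Hom_comm_monoid], of "Dom C h" "Cod C h" f g h] assms
  by (simp add: hom_monoid_def Hom_def)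

lemma Add_Zero [simp]:
  assumes "f \<in> Arr C" "A = Dom C f" "B = Cod C f"
  shows "f \<^bold>+ \<^bold>0 A B = f" "\<^bold>0 A B \<^bold>+ f = f"
  using monoid.r_one[OF comm_monoid.axioms(1)[OF Hom_comm_monoid], of A B f]
    monoid.l_one[OF comm_monoid.axioms(1)[OF Hom_comm_monoid], of A B f] assms
  by (simp_all add: hom_monoid_def Hom_def)

lemma Comp_Add_right:
  assumes "k \<in> Arr C" "f \<in> Arr C" "g \<in> Arr C" "Dom C f = Dom C g" "Cod C f = Cod C g"
    "Cod C k = Dom C g"
  shows "k \<Zcomp> (f \<^bold>+ g) = k \<Zcomp> f \<^bold>+ k \<Zcomp> g"
  using Comp_Add[of k "Dom C k" "Cod C k" f "Cod C g" g "\<^bold>1 (Cod C g)" "Cod C g"] assms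
  by (simp add: Hom_def)

lemma Comp_Add_left:
  assumes "h \<in> Arr C" "f \<in> Arr C" "g \<in> Arr C" "Dom C f = Dom C g" "Cod C f = Cod C g"
    "Cod C g = Dom C h"
  shows "(f \<^bold>+ g) \<Zcomp> h = f \<Zcomp> h \<^bold>+ g \<Zcomp> h"
  using Comp_Add[of "\<^bold>1 (Dom C g)" "Dom C g" "Dom C g" f "Cod C g" g h "Cod C h"] assms
  by (simp add: Hom_def)

lemma Tensor_Add_left:
  assumes "f \<in> Arr C" "g \<in> Arr C" "h \<in> Arr C" "Dom C f = Dom C g" "Cod C f = Cod C g"
  shows "(f \<^bold>+ g) \<otimes>\<^sub>a h = f \<otimes>\<^sub>a h \<^bold>+ g \<otimes>\<^sub>a h"
  using Tensor_Add[of "\<^bold>1 \<^bold>I" f "Dom C g" "Cod C g" g h] assms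
  by (simp add: Hom_def)

lemma Zero_Comp_arr [simp]:
  "\<lbrakk>A \<in> Obj C; f \<in> Arr C; B = Dom C f\<rbrakk> \<Longrightarrow> \<^bold>0 A B \<Zcomp> f = \<^bold>0 A (Cod C f)"
  by (rule Zero_Comp) (auto simp: Hom_def)

lemma Comp_Zero_arr [simp]:
  "\<lbrakk>D \<in> Obj C; f \<in> Arr C; B = Cod C f\<rbrakk> \<Longrightarrow> f \<Zcomp> \<^bold>0 B D = \<^bold>0 (Dom C f) D"
  by (rule Comp_Zero) (auto simp: Hom_def)

lemma Zero_Tensor_arr [simp]:
  "\<lbrakk>A \<in> Obj C; B \<in> Obj C; h \<in> Arr C\<rbrakk>
    \<Longrightarrow> \<^bold>0 A B \<otimes>\<^sub>a h = \<^bold>0 (A \<otimes>\<^sub>o Dom C h) (B \<otimes>\<^sub>o Cod C h)"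
  by (rule Zero_Tensor) (auto simp: Hom_def)

lemma Tensor_Zero_arr [simp]:
  "\<lbrakk>A \<in> Obj C; B \<in> Obj C; h \<in> Arr C\<rbrakk>
    \<Longrightarrow> h \<otimes>\<^sub>a \<^bold>0 A B = \<^bold>0 (Dom C h \<otimes>\<^sub>o A) (Cod C h \<otimes>\<^sub>o B)"
  by (rule Tensor_Zero) (auto simp: Hom_def)

end

section \<open>Naturality and symmetry of the coderiving transformation\<close>

context coalgebra_modality
begin

lemma obj_Bang [simp]: "A \<in> Obj C \<Longrightarrow> \<^bold>!\<^sub>o A \<in> Obj C"
  using Bang_functor by (simp add: endofunctor_def)

lemma arr_Bang [simp]:
  assumes "f \<in> Arr C"
  shows "\<^bold>!\<^sub>a f \<in> Arr C" "Dom C (\<^bold>!\<^sub>a f) = \<^bold>!\<^sub>o (Dom C f)" "Cod C (\<^bold>!\<^sub>a f) = \<^bold>!\<^sub>o (Cod C f)"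
  using Bang_functor assms by (auto simp: endofunctor_def Hom_def)

lemma Bang_Comp:
  "\<lbrakk>f \<in> Arr C; g \<in> Arr C; Cod C f = Dom C g\<rbrakk> \<Longrightarrow> \<^bold>!\<^sub>a f \<Zcomp> \<^bold>!\<^sub>a g = \<^bold>!\<^sub>a (f \<Zcomp> g)"
  using Bang_functor by (simp add: endofunctor_def)

lemma arr_CDelta [simp]:
  assumes "A \<in> Obj C"
  shows "\<^bold>\<delta> A \<in> Arr C" "Dom C (\<^bold>\<delta> A) = \<^bold>!\<^sub>o A" "Cod C (\<^bold>\<delta> A) = \<^bold>!\<^sub>o (\<^bold>!\<^sub>o A)"
  using CDelta_natural assms by (auto simp: natural_transformation_def Hom_def)

lemma arr_CEps [simp]:
  assumes "A \<in> Obj C"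
  shows "\<^bold>\<epsilon> A \<in> Arr C" "Dom C (\<^bold>\<epsilon> A) = \<^bold>!\<^sub>o A" "Cod C (\<^bold>\<epsilon> A) = A"
  using CEps_natural assms by (auto simp: natural_transformation_def Hom_def)

lemma arr_Copy [simp]:
  assumes "A \<in> Obj C"
  shows "\<^bold>\<Delta> A \<in> Arr C" "Dom C (\<^bold>\<Delta> A) = \<^bold>!\<^sub>o A" "Cod C (\<^bold>\<Delta> A) = \<^bold>!\<^sub>o A \<otimes>\<^sub>o \<^bold>!\<^sub>o A"
  using Copy_natural assms by (auto simp: natural_transformation_def Hom_def)

lemma arr_Discard [simp]:
  assumes "A \<in> Obj C"
  shows "\<^bold>e A \<in> Arr C" "Dom C (\<^bold>e A) = \<^bold>!\<^sub>o A" "Cod C (\<^bold>e A) = \<^bold>I"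
  using Discard_natural assms by (auto simp: natural_transformation_def Hom_def)

lemma arr_coderiving [simp]:
  assumes "A \<in> Obj C"
  shows "\<^bold>d\<degree> A \<in> Arr C" "Dom C (\<^bold>d\<degree> A) = \<^bold>!\<^sub>o A" "Cod C (\<^bold>d\<degree> A) = \<^bold>!\<^sub>o A \<otimes>\<^sub>o A"
  using assms by (auto simp: coderiving_def)

lemma CEps_slide: "f \<in> Arr C \<Longrightarrow> \<^bold>!\<^sub>a f \<Zcomp> \<^bold>\<epsilon> (Cod C f) = \<^bold>\<epsilon> (Dom C f) \<Zcomp> f"
  using CEps_natural by (simp add: natural_transformation_def)

lemma Copy_slide: "f \<in> Arr C \<Longrightarrow> \<^bold>!\<^sub>a f \<Zcomp> \<^bold>\<Delta> (Cod C f) = \<^bold>\<Delta> (Dom C f) \<Zcomp> (\<^bold>!\<^sub>a f \<otimes>\<^sub>a \<^bold>!\<^sub>a f)"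
  using Copy_natural by (simp add: natural_transformation_def)

lemma coderiving_slide:
  assumes "f \<in> Arr C"
  shows "\<^bold>!\<^sub>a f \<Zcomp> \<^bold>d\<degree> (Cod C f) = \<^bold>d\<degree> (Dom C f) \<Zcomp> (\<^bold>!\<^sub>a f \<otimes>\<^sub>a f)"
  using assms Copy_slide[THEN Comp_extend, of f "\<^bold>1 (\<^bold>!\<^sub>o (Cod C f)) \<otimes>\<^sub>a \<^bold>\<epsilon> (Cod C f)"]
  by (simp add: coderiving_def interchange CEps_slide)

text \<open>By coassociativity both extracted copies of \<open>A\<close> come from a single
  \<open>\<Delta> \<Zcomp> (\<epsilon> \<otimes> \<epsilon>)\<close> on the second tensor factor.
  Naturality moves the symmetry in front of the two counits, where cocommutativity absorbs
  it.\<close>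

lemma coderiving_twice_symmetric:
  assumes A: "A \<in> Obj C"
  shows "\<^bold>d\<degree> A \<Zcomp> (\<^bold>d\<degree> A \<otimes>\<^sub>a \<^bold>1 A) \<Zcomp> (\<^bold>1 (\<^bold>!\<^sub>o A) \<otimes>\<^sub>a \<^bold>\<sigma> A A) = \<^bold>d\<degree> A \<Zcomp> (\<^bold>d\<degree> A \<otimes>\<^sub>a \<^bold>1 A)"
proof -
  let ?i = "\<^bold>1 (\<^bold>!\<^sub>o A)" and ?ee = "\<^bold>\<epsilon> A \<otimes>\<^sub>a \<^bold>\<epsilon> A"
  have "\<^bold>d\<degree> A \<Zcomp> (\<^bold>d\<degree> A \<otimes>\<^sub>a \<^bold>1 A) = \<^bold>\<Delta> A \<Zcomp> (\<^bold>d\<degree> A \<otimes>\<^sub>a \<^bold>\<epsilon> A)"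
    using A by (simp add: coderiving_def[of C A] interchange)
  also have "\<^bold>d\<degree> A \<otimes>\<^sub>a \<^bold>\<epsilon> A = (\<^bold>\<Delta> A \<otimes>\<^sub>a ?i) \<Zcomp> (?i \<otimes>\<^sub>a \<^bold>\<epsilon> A \<otimes>\<^sub>a \<^bold>\<epsilon> A)"
    using A interchange[of "\<^bold>\<Delta> A" "?i \<otimes>\<^sub>a \<^bold>\<epsilon> A" ?i "\<^bold>\<epsilon> A"] by (simp add: coderiving_def)
  also have "\<^bold>\<Delta> A \<Zcomp> \<dots> = \<^bold>\<Delta> A \<Zcomp> (?i \<otimes>\<^sub>a (\<^bold>\<Delta> A \<Zcomp> ?ee))"
    using A Copy_coassoc[OF A, THEN Comp_extend, of "?i \<otimes>\<^sub>a ?ee"] by (simp add: interchange)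
  finally have dd: "\<^bold>d\<degree> A \<Zcomp> (\<^bold>d\<degree> A \<otimes>\<^sub>a \<^bold>1 A) = \<^bold>\<Delta> A \<Zcomp> (?i \<otimes>\<^sub>a (\<^bold>\<Delta> A \<Zcomp> ?ee))" .
  have "\<^bold>\<Delta> A \<Zcomp> (?ee \<Zcomp> \<^bold>\<sigma> A A) = \<^bold>\<Delta> A \<Zcomp> ?ee"
    using A Copy_cocommutative[OF A, THEN Comp_extend, of ?ee] by (simp add: Sym_slide)
  then show ?thesis
    unfolding dd using A by (simp add: interchange)
qed

end


section \<open>The degree operator and its commutation with deriving and coderiving\<close>

context differential_category
begin

lemma arr_Deriv [simp]:
  assumes "A \<in> Obj C"
  shows "\<^bold>d A \<in> Arr C" "Dom C (\<^bold>d A) = \<^bold>!\<^sub>o A \<otimes>\<^sub>o A" "Cod C (\<^bold>d A) = \<^bold>!\<^sub>o A"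
  using Deriv_natural assms by (auto simp: natural_transformation_def Hom_def)

lemma Deriv_slide: "f \<in> Arr C \<Longrightarrow> \<^bold>d (Dom C f) \<Zcomp> \<^bold>!\<^sub>a f = (\<^bold>!\<^sub>a f \<otimes>\<^sub>a f) \<Zcomp> \<^bold>d (Cod C f)"
  using Deriv_natural by (simp add: natural_transformation_def)

text \<open>This is the Leibniz rule [d.2] followed by \<open>1 \<otimes> \<epsilon>\<close>, a
  canonical commutation relation. Its identity summand causes the shift by one in
  \<open>Deriv_W\<close> and \<open>W_coderiving\<close>.\<close>

lemma Deriv_coderiving:
  assumes A: "A \<in> Obj C"
  shows "\<^bold>d A \<Zcomp> \<^bold>d\<degree> A = (\<^bold>d\<degree> A \<otimes>\<^sub>a \<^bold>1 A) \<Zcomp> (\<^bold>1 (\<^bold>!\<^sub>o A) \<otimes>\<^sub>a \<^bold>\<sigma> A A) \<Zcomp> (\<^bold>d A \<otimes>\<^sub>a \<^bold>1 A)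
    \<^bold>+ \<^bold>1 (\<^bold>!\<^sub>o A \<otimes>\<^sub>o A)"
proof -
  let ?i = "\<^bold>1 (\<^bold>!\<^sub>o A)" and ?j = "\<^bold>1 A"
  let ?\<Delta> = "\<^bold>\<Delta> A \<otimes>\<^sub>a ?j"
  let ?s = "?\<Delta> \<Zcomp> (?i \<otimes>\<^sub>a \<^bold>\<sigma> (\<^bold>!\<^sub>o A) A) \<Zcomp> (\<^bold>d A \<otimes>\<^sub>a ?i)" and ?t = "?\<Delta> \<Zcomp> (?i \<otimes>\<^sub>a \<^bold>d A)"
  have "\<^bold>d A \<Zcomp> \<^bold>d\<degree> A = (\<^bold>d A \<Zcomp> \<^bold>\<Delta> A) \<Zcomp> (?i \<otimes>\<^sub>a \<^bold>\<epsilon> A)"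
    using A by (simp add: coderiving_def)
  also have "\<dots> = ?s \<Zcomp> (?i \<otimes>\<^sub>a \<^bold>\<epsilon> A) \<^bold>+ ?t \<Zcomp> (?i \<otimes>\<^sub>a \<^bold>\<epsilon> A)"
    unfolding d2[OF A] using A by (subst Comp_Add_left) simp_all
  \<comment> \<open>In the summand where the second copy is differentiated, [d.3] leaves
    \<open>e\<close> on that copy and the counit law cancels \<open>\<Delta>\<close>.\<close>
  also have "?t \<Zcomp> (?i \<otimes>\<^sub>a \<^bold>\<epsilon> A) = ?\<Delta> \<Zcomp> ((?i \<otimes>\<^sub>a \<^bold>e A) \<otimes>\<^sub>a ?j)"
    using A by (simp add: interchange d3)
  also have "\<dots> = \<^bold>1 (\<^bold>!\<^sub>o A \<otimes>\<^sub>o A)"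
    using A Copy_counit_right[OF A] interchange[of "\<^bold>\<Delta> A" "?i \<otimes>\<^sub>a \<^bold>e A" ?j ?j] by simp
  \<comment> \<open>In the other summand \<open>\<epsilon>\<close> is moved before \<open>d\<close>
    and through the symmetry, until it meets \<open>\<Delta>\<close> and forms
    \<open>d\<degree>\<close>.\<close>
  also have "?s \<Zcomp> (?i \<otimes>\<^sub>a \<^bold>\<epsilon> A) = ?\<Delta> \<Zcomp> (?i \<otimes>\<^sub>a \<^bold>\<sigma> (\<^bold>!\<^sub>o A) A) \<Zcomp> ((?i \<otimes>\<^sub>a ?j \<otimes>\<^sub>a \<^bold>\<epsilon> A) \<Zcomp> (\<^bold>d A \<otimes>\<^sub>a ?j))"
    using A interchange[of "?i \<otimes>\<^sub>a ?j" "\<^bold>d A" "\<^bold>\<epsilon> A" ?j] by (simp add: interchange)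
  also have "\<dots> = ?\<Delta> \<Zcomp> ((?i \<otimes>\<^sub>a \<^bold>\<sigma> (\<^bold>!\<^sub>o A) A) \<Zcomp> (?i \<otimes>\<^sub>a (?j \<otimes>\<^sub>a \<^bold>\<epsilon> A))) \<Zcomp> (\<^bold>d A \<otimes>\<^sub>a ?j)"
    using A by (simp del: Tensor_Id)
  also have "(?i \<otimes>\<^sub>a \<^bold>\<sigma> (\<^bold>!\<^sub>o A) A) \<Zcomp> (?i \<otimes>\<^sub>a (?j \<otimes>\<^sub>a \<^bold>\<epsilon> A)) = (?i \<otimes>\<^sub>a (\<^bold>\<epsilon> A \<otimes>\<^sub>a ?j)) \<Zcomp> (?i \<otimes>\<^sub>a \<^bold>\<sigma> A A)"
    using A Sym_slide[of "\<^bold>\<epsilon> A" ?j A A] by (simp add: interchange)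
  also have "?\<Delta> \<Zcomp> \<dots> = (\<^bold>d\<degree> A \<otimes>\<^sub>a ?j) \<Zcomp> (?i \<otimes>\<^sub>a \<^bold>\<sigma> A A)"
    using A interchange[of "\<^bold>\<Delta> A" "?i \<otimes>\<^sub>a \<^bold>\<epsilon> A" ?j ?j, THEN Comp_extend, of "?i \<otimes>\<^sub>a \<^bold>\<sigma> A A"]
    by (simp add: coderiving_def)
  finally show ?thesis .
qed

definition W :: "'o \<Rightarrow> 'a" where
  "W A = \<^bold>d\<degree> A \<Zcomp> \<^bold>d A"

lemma arr_W [simp]:
  assumes "A \<in> Obj C"
  shows "W A \<in> Arr C" "Dom C (W A) = \<^bold>!\<^sub>o A" "Cod C (W A) = \<^bold>!\<^sub>o A"
  using assms by (simp_all add: W_def)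

lemma K_eq: "K C A = W A \<^bold>+ \<^bold>!\<^sub>a (\<^bold>0 A A)"
  by (simp add: K_def W_def)

lemma J_eq: "J C A = W A \<^bold>+ \<^bold>1 (\<^bold>!\<^sub>o A)"
  by (simp add: J_def W_def)

lemma arr_K [simp]:
  assumes "A \<in> Obj C"
  shows "K C A \<in> Arr C" "Dom C (K C A) = \<^bold>!\<^sub>o A" "Cod C (K C A) = \<^bold>!\<^sub>o A"
  using assms by (simp_all add: K_eq)

lemma arr_J [simp]:
  assumes "A \<in> Obj C"
  shows "J C A \<in> Arr C" "Dom C (J C A) = \<^bold>!\<^sub>o A" "Cod C (J C A) = \<^bold>!\<^sub>o A"
  using assms by (simp_all add: J_eq)

text \<open>Differentiation lowers the degree from k to k - 1, and \<open>J\<close> multiplies by k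
  in degree k - 1. The symmetry in the commutation relation is absorbed by [d.5].\<close>

lemma Deriv_W:
  assumes A: "A \<in> Obj C"
  shows "\<^bold>d A \<Zcomp> W A = (J C A \<otimes>\<^sub>a \<^bold>1 A) \<Zcomp> \<^bold>d A"
proof -
  let ?i = "\<^bold>1 (\<^bold>!\<^sub>o A)" and ?j = "\<^bold>1 A"
  have "\<^bold>d A \<Zcomp> W A = (\<^bold>d A \<Zcomp> \<^bold>d\<degree> A) \<Zcomp> \<^bold>d A"
    using A by (simp add: W_def)
  also have "\<dots> = (\<^bold>d\<degree> A \<otimes>\<^sub>a ?j) \<Zcomp> ((?i \<otimes>\<^sub>a \<^bold>\<sigma> A A) \<Zcomp> (\<^bold>d A \<otimes>\<^sub>a ?j) \<Zcomp> \<^bold>d A) \<^bold>+ \<^bold>d A"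
    unfolding Deriv_coderiving[OF A] using A by (simp add: Comp_Add_left)
  also have "\<dots> = (\<^bold>d\<degree> A \<otimes>\<^sub>a ?j) \<Zcomp> (\<^bold>d A \<otimes>\<^sub>a ?j) \<Zcomp> \<^bold>d A \<^bold>+ \<^bold>d A"
    unfolding d5[OF A, symmetric] using A by simp
  also have "\<dots> = (J C A \<otimes>\<^sub>a ?j) \<Zcomp> \<^bold>d A"
    using A interchange[of "\<^bold>d\<degree> A" "\<^bold>d A" ?j ?j, THEN Comp_extend, of "\<^bold>d A"]
    by (simp add: J_eq W_def Tensor_Add_left Comp_Add_left)
  finally show ?thesis .
qed

text \<open>The mirror image of \<open>Deriv_W\<close>; here
  \<open>coderiving_twice_symmetric\<close> absorbs the symmetry.\<close>

lemma W_coderiving: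
  assumes A: "A \<in> Obj C"
  shows "W A \<Zcomp> \<^bold>d\<degree> A = \<^bold>d\<degree> A \<Zcomp> (J C A \<otimes>\<^sub>a \<^bold>1 A)"
proof -
  let ?i = "\<^bold>1 (\<^bold>!\<^sub>o A)" and ?j = "\<^bold>1 A"
  have "W A \<Zcomp> \<^bold>d\<degree> A = \<^bold>d\<degree> A \<Zcomp> (\<^bold>d A \<Zcomp> \<^bold>d\<degree> A)"
    using A by (simp add: W_def)
  also have "\<dots> = (\<^bold>d\<degree> A \<Zcomp> (\<^bold>d\<degree> A \<otimes>\<^sub>a ?j) \<Zcomp> (?i \<otimes>\<^sub>a \<^bold>\<sigma> A A)) \<Zcomp> (\<^bold>d A \<otimes>\<^sub>a ?j) \<^bold>+ \<^bold>d\<degree> A"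
    unfolding Deriv_coderiving[OF A] using A by (simp add: Comp_Add_right)
  also have "\<dots> = \<^bold>d\<degree> A \<Zcomp> (\<^bold>d\<degree> A \<otimes>\<^sub>a ?j) \<Zcomp> (\<^bold>d A \<otimes>\<^sub>a ?j) \<^bold>+ \<^bold>d\<degree> A"
    unfolding coderiving_twice_symmetric[OF A] using A by simp
  also have "\<dots> = \<^bold>d\<degree> A \<Zcomp> (J C A \<otimes>\<^sub>a ?j)"
    using A by (simp add: J_eq W_def Tensor_Add_left Comp_Add_right interchange)
  finally show ?thesis .
qed

lemma W_slide:
  assumes f: "f \<in> Arr C"
  shows "\<^bold>!\<^sub>a f \<Zcomp> W (Cod C f) = W (Dom C f) \<Zcomp> \<^bold>!\<^sub>a f"
  using f coderiving_slide[OF f, THEN Comp_extend, of "\<^bold>d (Cod C f)"]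
  by (simp add: W_def Deriv_slide)

text \<open>\<open>\<epsilon>\<close> has degree one: [d.3] turns \<open>d\<close> into
  \<open>e \<otimes> 1\<close>, and the counit law removes the copy. By contrast, [d.1] puts
  \<open>e\<close> in degree zero in \<open>W_Discard\<close>.\<close>

lemma W_CEps: "A \<in> Obj C \<Longrightarrow> W A \<Zcomp> \<^bold>\<epsilon> A = \<^bold>\<epsilon> A"
  using Copy_counit_left[of A, THEN Comp_extend, of "\<^bold>\<epsilon> A"]
    interchange[of "\<^bold>1 (\<^bold>!\<^sub>o A)" "\<^bold>e A" "\<^bold>\<epsilon> A" "\<^bold>1 A"] interchange[of "\<^bold>e A" "\<^bold>1 \<^bold>I" "\<^bold>1 (\<^bold>!\<^sub>o A)" "\<^bold>\<epsilon> A"]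
  by (simp add: W_def d3 coderiving_def)

lemma W_Discard: "A \<in> Obj C \<Longrightarrow> W A \<Zcomp> \<^bold>e A = \<^bold>0 (\<^bold>!\<^sub>o A) \<^bold>I"
  by (simp add: W_def d1)

text \<open>\<open>!(0)\<close> itself need not be zero, but naturality turns it into a tensor with
  the factor \<open>0\<close>, and such a tensor vanishes.\<close>

lemma Bang_Zero_coderiving:
  "A \<in> Obj C \<Longrightarrow> \<^bold>!\<^sub>a (\<^bold>0 A A) \<Zcomp> \<^bold>d\<degree> A = \<^bold>0 (\<^bold>!\<^sub>o A) (\<^bold>!\<^sub>o A \<otimes>\<^sub>o A)"
  using coderiving_slide[of "\<^bold>0 A A"] by simp

lemma Deriv_Bang_Zero:
  "A \<in> Obj C \<Longrightarrow> \<^bold>d A \<Zcomp> \<^bold>!\<^sub>a (\<^bold>0 A A) = \<^bold>0 (\<^bold>!\<^sub>o A \<otimes>\<^sub>o A) (\<^bold>!\<^sub>o A)"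
  using Deriv_slide[of "\<^bold>0 A A"] by simp

lemma Bang_Zero_idem: "A \<in> Obj C \<Longrightarrow> \<^bold>!\<^sub>a (\<^bold>0 A A) \<Zcomp> \<^bold>!\<^sub>a (\<^bold>0 A A) = \<^bold>!\<^sub>a (\<^bold>0 A A)"
  by (simp add: Bang_Comp)

text \<open>The summand \<open>!(0)\<close> of \<open>K\<close> annihilates
  \<open>d\<degree>\<close>, so \<open>K\<close> crosses it as \<open>W\<close> does. Together with
  \<open>Jn_coderiving\<close> this makes K, J, J_1, J_2, ... a chain in which crossing
  \<open>d\<degree>\<close> advances one place.\<close>

lemma K_coderiving: "A \<in> Obj C \<Longrightarrow> K C A \<Zcomp> \<^bold>d\<degree> A = \<^bold>d\<degree> A \<Zcomp> (J C A \<otimes>\<^sub>a \<^bold>1 A)"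
  by (simp add: K_eq Comp_Add_left W_coderiving Bang_Zero_coderiving)

lemma hom_monoid_simps:
  "carrier (hom_monoid C A B) = Hom C A B"
  "\<one>\<^bsub>hom_monoid C A B\<^esub> = \<^bold>0 A B"
  "f \<otimes>\<^bsub>hom_monoid C A B\<^esub> g = f \<^bold>+ g"
  by (simp_all add: hom_monoid_def)

lemma Id_multiple_closed:
  fixes n :: nat
  assumes "A \<in> Obj C"
  shows "\<^bold>1 A [^]\<^bsub>hom_monoid C A A\<^esub> n \<in> Hom C A A"
  using monoid.nat_pow_closed[OF comm_monoid.axioms(1)[OF Hom_comm_monoid], of A A "\<^bold>1 A" n]
    Id_closed[OF assms] assms
  unfolding hom_monoid_simps by blast

lemma Jn_0: "A \<in> Obj C \<Longrightarrow> Jn C 0 A = J C A"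
  by (simp add: Jn_def hom_monoid_simps)

lemma arr_Jn [simp]:
  assumes "A \<in> Obj C"
  shows "Jn C n A \<in> Arr C" "Dom C (Jn C n A) = \<^bold>!\<^sub>o A" "Cod C (Jn C n A) = \<^bold>!\<^sub>o A"
  using assms HomD[OF Id_multiple_closed, of "\<^bold>!\<^sub>o A" n] by (simp_all add: Jn_def)

lemma Jn_Suc: "A \<in> Obj C \<Longrightarrow> Jn C (Suc n) A = Jn C n A \<^bold>+ \<^bold>1 (\<^bold>!\<^sub>o A)"
  using HomD[OF Id_multiple_closed, of "\<^bold>!\<^sub>o A" n]
  by (simp add: Jn_def hom_monoid_simps Add_assoc)

lemma Jn_coderiving:
  "A \<in> Obj C \<Longrightarrow> Jn C n A \<Zcomp> \<^bold>d\<degree> A = \<^bold>d\<degree> A \<Zcomp> (Jn C (Suc n) A \<otimes>\<^sub>a \<^bold>1 A)"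
  by (induction n)
    (simp_all add: Jn_0 Jn_Suc J_eq Comp_Add_left Comp_Add_right Tensor_Add_left W_coderiving)

lemma J_coderiving:
  "A \<in> Obj C \<Longrightarrow> J C A \<Zcomp> \<^bold>d\<degree> A = \<^bold>d\<degree> A \<Zcomp> (Jn C 1 A \<otimes>\<^sub>a \<^bold>1 A)"
  using Jn_coderiving[of A 0] by (simp add: Jn_0)

lemma Deriv_J:
  "A \<in> Obj C \<Longrightarrow> \<^bold>d A \<Zcomp> J C A = (Jn C 1 A \<otimes>\<^sub>a \<^bold>1 A) \<Zcomp> \<^bold>d A"
  by (simp add: Jn_0 Jn_Suc J_eq Comp_Add_left Comp_Add_right Tensor_Add_left Deriv_W)

lemma K_slide: "f \<in> Arr C \<Longrightarrow> \<^bold>!\<^sub>a f \<Zcomp> K C (Cod C f) = K C (Dom C f) \<Zcomp> \<^bold>!\<^sub>a f"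
  by (simp add: K_eq Comp_Add_left Comp_Add_right W_slide Bang_Comp)

lemma Jn_slide: "f \<in> Arr C \<Longrightarrow> \<^bold>!\<^sub>a f \<Zcomp> Jn C n (Cod C f) = Jn C n (Dom C f) \<Zcomp> \<^bold>!\<^sub>a f"
  by (induction n) (simp_all add: Jn_0 Jn_Suc J_eq Comp_Add_left Comp_Add_right W_slide)

section \<open>Raising the degree by one by passing through \<open>!!A\<close>\<close>

definition shift :: "'o \<Rightarrow> 'a" where
  "shift A = \<^bold>d\<degree> (\<^bold>!\<^sub>o A) \<Zcomp> (\<^bold>!\<^sub>a (\<^bold>\<epsilon> A) \<otimes>\<^sub>a \<^bold>e A)"

text \<open>\<open>W\<close> extended from \<open>!A\<close> to \<open>!!A\<close> as a derivation:
  one \<open>!A\<close> is extracted, acted on by \<open>W\<close> and put back.\<close>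

definition inner_W :: "'o \<Rightarrow> 'a" where
  "inner_W A = \<^bold>d\<degree> (\<^bold>!\<^sub>o A) \<Zcomp> (\<^bold>1 (\<^bold>!\<^sub>o (\<^bold>!\<^sub>o A)) \<otimes>\<^sub>a W A) \<Zcomp> \<^bold>d (\<^bold>!\<^sub>o A)"

text \<open>This is \<open>inner_W\<close> plus n + 1 identities, since J_0 = \<open>J\<close>
  already contains one; the recursion matches \<open>Jn_Suc\<close>.\<close>

primrec inner_Jn :: "nat \<Rightarrow> 'o \<Rightarrow> 'a" where
  "inner_Jn 0 A = inner_W A \<^bold>+ \<^bold>1 (\<^bold>!\<^sub>o (\<^bold>!\<^sub>o A))"
| "inner_Jn (Suc n) A = inner_Jn n A \<^bold>+ \<^bold>1 (\<^bold>!\<^sub>o (\<^bold>!\<^sub>o A))"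

lemma arr_shift [simp]:
  assumes "A \<in> Obj C"
  shows "shift A \<in> Arr C" "Dom C (shift A) = \<^bold>!\<^sub>o (\<^bold>!\<^sub>o A)" "Cod C (shift A) = \<^bold>!\<^sub>o A"
  using assms by (simp_all add: shift_def)

lemma arr_inner_W [simp]:
  assumes "A \<in> Obj C"
  shows "inner_W A \<in> Arr C" "Dom C (inner_W A) = \<^bold>!\<^sub>o (\<^bold>!\<^sub>o A)" "Cod C (inner_W A) = \<^bold>!\<^sub>o (\<^bold>!\<^sub>o A)"
  using assms by (simp_all add: inner_W_def)

lemma arr_inner_Jn [simp]:
  assumes "A \<in> Obj C"
  shows "inner_Jn n A \<in> Arr C" "Dom C (inner_Jn n A) = \<^bold>!\<^sub>o (\<^bold>!\<^sub>o A)"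
    "Cod C (inner_Jn n A) = \<^bold>!\<^sub>o (\<^bold>!\<^sub>o A)"
proof -
  have "inner_Jn n A \<in> Hom C (\<^bold>!\<^sub>o (\<^bold>!\<^sub>o A)) (\<^bold>!\<^sub>o (\<^bold>!\<^sub>o A))"
    using assms by (induction n) (simp_all add: Hom_def)
  then show "inner_Jn n A \<in> Arr C" "Dom C (inner_Jn n A) = \<^bold>!\<^sub>o (\<^bold>!\<^sub>o A)"
    "Cod C (inner_Jn n A) = \<^bold>!\<^sub>o (\<^bold>!\<^sub>o A)"
    by (rule HomD)+
qed

text \<open>\<open>\<delta>\<close> commutes with copying, and on the second copy the comonad counit
  cancels it.\<close>

lemma CDelta_coderiving:
  assumes A: "A \<in> Obj C"
  shows "\<^bold>\<delta> A \<Zcomp> \<^bold>d\<degree> (\<^bold>!\<^sub>o A) = \<^bold>\<Delta> A \<Zcomp> (\<^bold>\<delta> A \<otimes>\<^sub>a \<^bold>1 (\<^bold>!\<^sub>o A))"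
  using A CDelta_Copy[OF A, THEN Comp_extend, of "\<^bold>1 (\<^bold>!\<^sub>o (\<^bold>!\<^sub>o A)) \<otimes>\<^sub>a \<^bold>\<epsilon> (\<^bold>!\<^sub>o A)"]
  by (simp add: coderiving_def interchange comonad_counit_left)

text \<open>In \<open>shift\<close> the map \<open>e\<close>, read as a linear form on
  \<open>!A\<close>, is the formal variable; \<open>\<delta>\<close> erases it, because copying and
  then discarding is the identity.\<close>

lemma CDelta_shift:
  assumes A: "A \<in> Obj C"
  shows "\<^bold>\<delta> A \<Zcomp> shift A = \<^bold>1 (\<^bold>!\<^sub>o A)"
  using A CDelta_coderiving[OF A, THEN Comp_extend, of "\<^bold>!\<^sub>a (\<^bold>\<epsilon> A) \<otimes>\<^sub>a \<^bold>e A"]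
  by (simp add: shift_def interchange comonad_counit_right Copy_counit_right)

text \<open>The chain rule [d.4] rewrites \<open>d \<Zcomp> \<delta>\<close>; coassociativity then
  gathers \<open>d\<degree>\<close> and \<open>d\<close> into a \<open>W\<close> on the second copy,
  which is the copy that \<open>inner_W\<close> extracts after \<open>\<delta>\<close>.\<close>

lemma W_CDelta:
  assumes A: "A \<in> Obj C"
  shows "W A \<Zcomp> \<^bold>\<delta> A = \<^bold>\<delta> A \<Zcomp> inner_W A"
proof -
  let ?i = "\<^bold>1 (\<^bold>!\<^sub>o A)" and ?j = "\<^bold>1 A"
  have "\<^bold>d\<degree> A \<Zcomp> (\<^bold>\<Delta> A \<otimes>\<^sub>a ?j) = \<^bold>\<Delta> A \<Zcomp> (\<^bold>\<Delta> A \<otimes>\<^sub>a ?i) \<Zcomp> (?i \<otimes>\<^sub>a ?i \<otimes>\<^sub>a \<^bold>\<epsilon> A)"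
    using A interchange[of "\<^bold>\<Delta> A" "?i \<otimes>\<^sub>a ?i" ?i "\<^bold>\<epsilon> A"] by (simp add: coderiving_def interchange)
  also have "\<dots> = \<^bold>\<Delta> A \<Zcomp> (?i \<otimes>\<^sub>a \<^bold>d\<degree> A)"
    unfolding Copy_coassoc[OF A] using A by (simp add: coderiving_def interchange del: Tensor_Id)
  finally have c: "\<^bold>d\<degree> A \<Zcomp> (\<^bold>\<Delta> A \<otimes>\<^sub>a ?j) = \<^bold>\<Delta> A \<Zcomp> (?i \<otimes>\<^sub>a \<^bold>d\<degree> A)" .
  let ?r = "(\<^bold>\<delta> A \<otimes>\<^sub>a \<^bold>d A) \<Zcomp> \<^bold>d (\<^bold>!\<^sub>o A)"
  have "(\<^bold>\<delta> A \<otimes>\<^sub>a (?i \<otimes>\<^sub>a ?j)) \<Zcomp> ((\<^bold>1 (\<^bold>!\<^sub>o (\<^bold>!\<^sub>o A)) \<otimes>\<^sub>a \<^bold>d A) \<Zcomp> \<^bold>d (\<^bold>!\<^sub>o A)) = ?r"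
    using A interchange[of "\<^bold>\<delta> A" "\<^bold>1 (\<^bold>!\<^sub>o (\<^bold>!\<^sub>o A))" "?i \<otimes>\<^sub>a ?j" "\<^bold>d A",
        THEN Comp_extend, of "\<^bold>d (\<^bold>!\<^sub>o A)"] by simp
  then have "W A \<Zcomp> \<^bold>\<delta> A = \<^bold>d\<degree> A \<Zcomp> ((\<^bold>\<Delta> A \<otimes>\<^sub>a ?j) \<Zcomp> ?r)"
    using A by (simp add: W_def d4)
  also have "\<dots> = \<^bold>\<Delta> A \<Zcomp> ((?i \<otimes>\<^sub>a \<^bold>d\<degree> A) \<Zcomp> ?r)"
    using A c[THEN Comp_extend, of ?r] by simp
  also have "\<dots> = \<^bold>\<Delta> A \<Zcomp> ((\<^bold>\<delta> A \<otimes>\<^sub>a W A) \<Zcomp> \<^bold>d (\<^bold>!\<^sub>o A))"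
    using A interchange[of ?i "\<^bold>\<delta> A" "\<^bold>d\<degree> A" "\<^bold>d A", THEN Comp_extend, of "\<^bold>d (\<^bold>!\<^sub>o A)"]
    by (simp add: W_def)
  also have "\<dots> = \<^bold>\<delta> A \<Zcomp> inner_W A"
    using A CDelta_coderiving[OF A, THEN Comp_extend,
        of "(\<^bold>1 (\<^bold>!\<^sub>o (\<^bold>!\<^sub>o A)) \<otimes>\<^sub>a W A) \<Zcomp> \<^bold>d (\<^bold>!\<^sub>o A)"]
      interchange[of "\<^bold>\<delta> A" "\<^bold>1 (\<^bold>!\<^sub>o (\<^bold>!\<^sub>o A))" ?i "W A", THEN Comp_extend, of "\<^bold>d (\<^bold>!\<^sub>o A)"]
    by (simp add: inner_W_def)
  finally show ?thesis .
qed

text \<open>The commutation relation at \<open>!A\<close> splits the composite in two. In the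
  identity summand \<open>W\<close> meets \<open>e\<close> and gives zero; in the other it meets
  \<open>\<epsilon>\<close> and disappears, leaving the degree operator of \<open>!!A\<close>, which
  naturality along \<open>\<epsilon>\<close> turns into \<open>W A\<close>.\<close>

lemma inner_W_shift:
  assumes A: "A \<in> Obj C"
  shows "inner_W A \<Zcomp> shift A = shift A \<Zcomp> W A"
proof -
  let ?B = "\<^bold>!\<^sub>o A"
  let ?k = "\<^bold>1 (\<^bold>!\<^sub>o ?B)" and ?i = "\<^bold>1 ?B" and ?s = "\<^bold>!\<^sub>a (\<^bold>\<epsilon> A) \<otimes>\<^sub>a \<^bold>e A"
  have B: "?B \<in> Obj C"
    using A by simp
  have z: "(?k \<otimes>\<^sub>a W A) \<Zcomp> ?s = \<^bold>0 (\<^bold>!\<^sub>o ?B \<otimes>\<^sub>o ?B) ?B"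
    using A by (simp add: interchange W_Discard)
  have t1: "(\<^bold>d ?B \<otimes>\<^sub>a ?i) \<Zcomp> ?s = (\<^bold>!\<^sub>a (\<^bold>\<epsilon> A) \<otimes>\<^sub>a \<^bold>\<epsilon> A \<otimes>\<^sub>a \<^bold>e A) \<Zcomp> \<^bold>d A"
    using A Deriv_slide[of "\<^bold>\<epsilon> A"] interchange[of "\<^bold>!\<^sub>a (\<^bold>\<epsilon> A) \<otimes>\<^sub>a \<^bold>\<epsilon> A" "\<^bold>d A" "\<^bold>e A" "\<^bold>1 \<^bold>I"]
    by (simp add: interchange)
  \<comment> \<open>The symmetry exchanges the two extracted copies and carries \<open>W\<close> to
    the one that will meet \<open>\<epsilon>\<close>.\<close>
  have t2: "(?k \<otimes>\<^sub>a W A) \<Zcomp> ((\<^bold>d\<degree> ?B \<otimes>\<^sub>a ?i) \<Zcomp> (?k \<otimes>\<^sub>a \<^bold>\<sigma> ?B ?B)) =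
      (\<^bold>d\<degree> ?B \<otimes>\<^sub>a ?i) \<Zcomp> (?k \<otimes>\<^sub>a \<^bold>\<sigma> ?B ?B) \<Zcomp> (?k \<otimes>\<^sub>a W A \<otimes>\<^sub>a ?i)"
  proof -
    have "(?i \<otimes>\<^sub>a W A) \<Zcomp> \<^bold>\<sigma> ?B ?B = \<^bold>\<sigma> ?B ?B \<Zcomp> (W A \<otimes>\<^sub>a ?i)"
      using A by (simp add: Sym_slide)
    then have "(?k \<otimes>\<^sub>a (?i \<otimes>\<^sub>a W A)) \<Zcomp> (?k \<otimes>\<^sub>a \<^bold>\<sigma> ?B ?B) = (?k \<otimes>\<^sub>a \<^bold>\<sigma> ?B ?B) \<Zcomp> (?k \<otimes>\<^sub>a (W A \<otimes>\<^sub>a ?i))"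
      using A by (simp add: interchange)
    moreover have "(?k \<otimes>\<^sub>a W A) \<Zcomp> (\<^bold>d\<degree> ?B \<otimes>\<^sub>a ?i) = (\<^bold>d\<degree> ?B \<otimes>\<^sub>a ?i) \<Zcomp> (?k \<otimes>\<^sub>a ?i \<otimes>\<^sub>a W A)"
      using A interchange[of "\<^bold>d\<degree> ?B" "?k \<otimes>\<^sub>a ?i" ?i "W A"] by (simp add: interchange)
    from this[THEN Comp_extend, of "?k \<otimes>\<^sub>a \<^bold>\<sigma> ?B ?B"]
    have "(?k \<otimes>\<^sub>a W A) \<Zcomp> ((\<^bold>d\<degree> ?B \<otimes>\<^sub>a ?i) \<Zcomp> (?k \<otimes>\<^sub>a \<^bold>\<sigma> ?B ?B)) =
        (\<^bold>d\<degree> ?B \<otimes>\<^sub>a ?i) \<Zcomp> ((?k \<otimes>\<^sub>a ?i \<otimes>\<^sub>a W A) \<Zcomp> (?k \<otimes>\<^sub>a \<^bold>\<sigma> ?B ?B))"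
      using A by (simp del: Tensor_Id)
    ultimately show ?thesis
      using A by (simp del: Tensor_Id)
  qed
  let ?P = "(\<^bold>d\<degree> ?B \<otimes>\<^sub>a ?i) \<Zcomp> (?k \<otimes>\<^sub>a \<^bold>\<sigma> ?B ?B)"
  have "inner_W A \<Zcomp> shift A = \<^bold>d\<degree> ?B \<Zcomp> ((?k \<otimes>\<^sub>a W A) \<Zcomp> (\<^bold>d ?B \<Zcomp> \<^bold>d\<degree> ?B) \<Zcomp> ?s)"
    using A by (simp add: inner_W_def shift_def)
  also have "(?k \<otimes>\<^sub>a W A) \<Zcomp> (\<^bold>d ?B \<Zcomp> \<^bold>d\<degree> ?B) \<Zcomp> ?s =
      ((?k \<otimes>\<^sub>a W A) \<Zcomp> ?P) \<Zcomp> ((\<^bold>d ?B \<otimes>\<^sub>a ?i) \<Zcomp> ?s)"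
    unfolding Deriv_coderiving[OF B] using A z by (simp add: Comp_Add_left Comp_Add_right)
  also have "\<dots> = ?P \<Zcomp> ((?k \<otimes>\<^sub>a W A \<otimes>\<^sub>a ?i) \<Zcomp> (\<^bold>!\<^sub>a (\<^bold>\<epsilon> A) \<otimes>\<^sub>a \<^bold>\<epsilon> A \<otimes>\<^sub>a \<^bold>e A)) \<Zcomp> \<^bold>d A"
    unfolding t1 t2 using A by simp
  also have "(?k \<otimes>\<^sub>a W A \<otimes>\<^sub>a ?i) \<Zcomp> (\<^bold>!\<^sub>a (\<^bold>\<epsilon> A) \<otimes>\<^sub>a \<^bold>\<epsilon> A \<otimes>\<^sub>a \<^bold>e A) = \<^bold>!\<^sub>a (\<^bold>\<epsilon> A) \<otimes>\<^sub>a \<^bold>\<epsilon> A \<otimes>\<^sub>a \<^bold>e A"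
    using A by (simp add: interchange W_CEps)
  \<comment> \<open>With \<open>W\<close> absorbed, \<open>t1\<close> is read backwards to restore
    \<open>d\<close>, so that the symmetry can be removed.\<close>
  also have "\<^bold>d\<degree> ?B \<Zcomp> (?P \<Zcomp> (\<^bold>!\<^sub>a (\<^bold>\<epsilon> A) \<otimes>\<^sub>a \<^bold>\<epsilon> A \<otimes>\<^sub>a \<^bold>e A) \<Zcomp> \<^bold>d A) =
      (\<^bold>d\<degree> ?B \<Zcomp> (\<^bold>d\<degree> ?B \<otimes>\<^sub>a ?i) \<Zcomp> (?k \<otimes>\<^sub>a \<^bold>\<sigma> ?B ?B)) \<Zcomp> ((\<^bold>d ?B \<otimes>\<^sub>a ?i) \<Zcomp> ?s)"
    unfolding t1 using A by simp
  also have "\<dots> = \<^bold>d\<degree> ?B \<Zcomp> ((W ?B \<Zcomp> \<^bold>!\<^sub>a (\<^bold>\<epsilon> A)) \<otimes>\<^sub>a \<^bold>e A)"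
    unfolding coderiving_twice_symmetric[OF B] using A by (simp add: interchange W_def)
  also have "\<dots> = shift A \<Zcomp> W A"
    using A W_slide[of "\<^bold>\<epsilon> A"] interchange[of "\<^bold>!\<^sub>a (\<^bold>\<epsilon> A)" "W A" "\<^bold>e A" "\<^bold>1 \<^bold>I"]
    by (simp add: shift_def)
  finally show ?thesis .
qed

text \<open>Between \<open>d\<degree>\<close> and \<open>d\<close> the outer \<open>W\<close>
  becomes \<open>J\<close> on the remaining factor, while the inner one acts on the extracted
  factor; maps on different tensor factors commute.\<close>

lemma inner_W_W:
  assumes A: "A \<in> Obj C"
  shows "inner_W A \<Zcomp> W (\<^bold>!\<^sub>o A) = W (\<^bold>!\<^sub>o A) \<Zcomp> inner_W A"
proof -
  let ?B = "\<^bold>!\<^sub>o A"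
  let ?k = "\<^bold>1 (\<^bold>!\<^sub>o ?B)" and ?i = "\<^bold>1 ?B"
  have B: "?B \<in> Obj C"
    using A by simp
  have "inner_W A \<Zcomp> W ?B = \<^bold>d\<degree> ?B \<Zcomp> (((?k \<otimes>\<^sub>a W A) \<Zcomp> (J C ?B \<otimes>\<^sub>a ?i)) \<Zcomp> \<^bold>d ?B)"
    using A Deriv_W[OF B] by (simp add: inner_W_def)
  also have "(?k \<otimes>\<^sub>a W A) \<Zcomp> (J C ?B \<otimes>\<^sub>a ?i) = (J C ?B \<otimes>\<^sub>a ?i) \<Zcomp> (?k \<otimes>\<^sub>a W A)"
    using A by (simp add: interchange)
  also have "\<^bold>d\<degree> ?B \<Zcomp> (\<dots> \<Zcomp> \<^bold>d ?B) = W ?B \<Zcomp> inner_W A"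
    using A W_coderiving[OF B, THEN Comp_extend, of "(?k \<otimes>\<^sub>a W A) \<Zcomp> \<^bold>d ?B"]
    by (simp add: inner_W_def)
  finally show ?thesis .
qed

lemma inner_W_K:
  assumes A: "A \<in> Obj C"
  shows "inner_W A \<Zcomp> K C (\<^bold>!\<^sub>o A) = K C (\<^bold>!\<^sub>o A) \<Zcomp> inner_W A"
proof -
  let ?B = "\<^bold>!\<^sub>o A"
  have B: "?B \<in> Obj C"
    using A by simp
  have "inner_W A \<Zcomp> \<^bold>!\<^sub>a (\<^bold>0 ?B ?B) = \<^bold>0 (\<^bold>!\<^sub>o ?B) (\<^bold>!\<^sub>o ?B)"
    using A Deriv_Bang_Zero[OF B] by (simp add: inner_W_def)
  moreover have "\<^bold>!\<^sub>a (\<^bold>0 ?B ?B) \<Zcomp> inner_W A = \<^bold>0 (\<^bold>!\<^sub>o ?B) (\<^bold>!\<^sub>o ?B)"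
    using A Bang_Zero_coderiving[OF B, THEN Comp_extend, of "(\<^bold>1 (\<^bold>!\<^sub>o ?B) \<otimes>\<^sub>a W A) \<Zcomp> \<^bold>d ?B"]
    by (simp add: inner_W_def)
  ultimately show ?thesis
    using A by (simp add: K_eq Comp_Add_left Comp_Add_right inner_W_W)
qed

lemma inner_W_Jn:
  "A \<in> Obj C \<Longrightarrow> inner_W A \<Zcomp> Jn C n (\<^bold>!\<^sub>o A) = Jn C n (\<^bold>!\<^sub>o A) \<Zcomp> inner_W A"
  by (induction n) (simp_all add: Jn_0 Jn_Suc J_eq Comp_Add_left Comp_Add_right inner_W_W)

lemma inner_Jn_commute:
  assumes "A \<in> Obj C" "P \<in> Hom C (\<^bold>!\<^sub>o (\<^bold>!\<^sub>o A)) (\<^bold>!\<^sub>o (\<^bold>!\<^sub>o A))" "inner_W A \<Zcomp> P = P \<Zcomp> inner_W A"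
  shows "inner_Jn n A \<Zcomp> P = P \<Zcomp> inner_Jn n A"
  using assms by (induction n) (simp_all add: Hom_def Comp_Add_left Comp_Add_right)

lemma Jn_CDelta:
  "A \<in> Obj C \<Longrightarrow> Jn C n A \<Zcomp> \<^bold>\<delta> A = \<^bold>\<delta> A \<Zcomp> inner_Jn n A"
  by (induction n) (simp_all add: Jn_0 Jn_Suc J_eq Comp_Add_left Comp_Add_right W_CDelta)

lemma inner_Jn_shift:
  "A \<in> Obj C \<Longrightarrow> inner_Jn n A \<Zcomp> shift A = shift A \<Zcomp> Jn C n A"
  by (induction n) (simp_all add: Jn_0 Jn_Suc J_eq Comp_Add_left Comp_Add_right inner_W_shift)

text \<open>The common core of (i) and (ii): \<open>P\<close> is \<open>K\<close> at
  \<open>!A\<close> for n = 0, and J_(n-1) at \<open>!A\<close> for n > 0.\<close>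

lemma isomorphism_Jn_by_shift:
  assumes A: "A \<in> Obj C"
    and P: "P \<in> Hom C (\<^bold>!\<^sub>o (\<^bold>!\<^sub>o A)) (\<^bold>!\<^sub>o (\<^bold>!\<^sub>o A))" "isomorphism C P"
    and P_W: "inner_W A \<Zcomp> P = P \<Zcomp> inner_W A"
    and P_coderiving: "P \<Zcomp> \<^bold>d\<degree> (\<^bold>!\<^sub>o A) = \<^bold>d\<degree> (\<^bold>!\<^sub>o A) \<Zcomp> (Jn C n (\<^bold>!\<^sub>o A) \<otimes>\<^sub>a \<^bold>1 (\<^bold>!\<^sub>o A))"
  shows "isomorphism C (Jn C n A)"
proof -
  let ?Q = "Jn C n A" and ?R = "inner_Jn n A"
  obtain P' where P': "P' \<in> Hom C (\<^bold>!\<^sub>o (\<^bold>!\<^sub>o A)) (\<^bold>!\<^sub>o (\<^bold>!\<^sub>o A))"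
      "P \<Zcomp> P' = \<^bold>1 (\<^bold>!\<^sub>o (\<^bold>!\<^sub>o A))" "P' \<Zcomp> P = \<^bold>1 (\<^bold>!\<^sub>o (\<^bold>!\<^sub>o A))"
    using P by (auto simp: isomorphism_def Hom_def)
  note [simp] = HomD[OF P(1)] HomD[OF P'(1)]
  have P_shift: "P \<Zcomp> shift A = shift A \<Zcomp> ?Q"
  proof -
    let ?s = "\<^bold>!\<^sub>a (\<^bold>\<epsilon> A) \<otimes>\<^sub>a \<^bold>e A"
    have "P \<Zcomp> shift A = \<^bold>d\<degree> (\<^bold>!\<^sub>o A) \<Zcomp> ((Jn C n (\<^bold>!\<^sub>o A) \<otimes>\<^sub>a \<^bold>1 (\<^bold>!\<^sub>o A)) \<Zcomp> ?s)"
      using A P_coderiving[THEN Comp_extend, of ?s] by (simp add: shift_def)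
    also have "\<dots> = shift A \<Zcomp> ?Q"
      using A Jn_slide[of "\<^bold>\<epsilon> A" n] interchange[of "\<^bold>!\<^sub>a (\<^bold>\<epsilon> A)" ?Q "\<^bold>e A" "\<^bold>1 \<^bold>I"]
      by (simp add: interchange shift_def)
    finally show ?thesis .
  qed
  let ?T = "\<^bold>\<delta> A \<Zcomp> P' \<Zcomp> shift A"
  have left: "?T \<Zcomp> ?Q = \<^bold>1 (\<^bold>!\<^sub>o A)"
    using A P'(3)[THEN Comp_extend, of "shift A"] by (simp add: P_shift[symmetric] CDelta_shift)
  \<comment> \<open>Commuting with \<open>P\<close> passes to its inverse. Hence \<open>?R\<close>
    can cross \<open>P'\<close> and then \<open>shift A\<close>, where it becomes \<open>?Q\<close>;
    both composites of \<open>?Q\<close> and \<open>?T\<close> are thus the same arrow.\<close>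
  have "?R \<Zcomp> P' = P' \<Zcomp> (P \<Zcomp> ?R) \<Zcomp> P'"
    using A P'(3)[THEN Comp_extend, of "?R \<Zcomp> P'"] by simp
  also have "\<dots> = P' \<Zcomp> ?R"
    unfolding inner_Jn_commute[OF A P(1) P_W, symmetric] using A P'(2) by simp
  finally have "?Q \<Zcomp> ?T = \<^bold>\<delta> A \<Zcomp> (P' \<Zcomp> ?R) \<Zcomp> shift A"
    using A Jn_CDelta[OF A, of n, THEN Comp_extend, of "P' \<Zcomp> shift A"]
      Comp_extend[of ?R P' _ "shift A"] by simp
  also have "\<dots> = ?T \<Zcomp> ?Q"
    using A by (simp add: inner_Jn_shift)
  finally have right: "?Q \<Zcomp> ?T = \<^bold>1 (\<^bold>!\<^sub>o A)"
    using left by simp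
  have "?T \<in> Hom C (\<^bold>!\<^sub>o A) (\<^bold>!\<^sub>o A)"
    using A by (simp add: Hom_def)
  then show ?thesis
    unfolding isomorphism_def arr_Jn[OF A] using left right arr_Jn(1)[OF A] by blast
qed

section \<open>Inverting \<open>K\<close> by means of the Taylor property\<close>

lemma isomorphism_inverse:
  assumes "A \<in> Obj C" "isomorphism C f" "f \<in> Hom C A A"
  obtains g where "g \<in> Hom C A A" "f \<Zcomp> g = \<^bold>1 A" "g \<Zcomp> f = \<^bold>1 A"
  using assms by (auto simp: isomorphism_def Hom_def)

lemma conjugate_inverse:
  assumes "f \<Zcomp> u = v \<Zcomp> f" "u \<Zcomp> u' = \<^bold>1 B" "v' \<Zcomp> v = \<^bold>1 A"
    and "f \<in> Hom C A B" "u \<in> Hom C B B" "u' \<in> Hom C B B" "v \<in> Hom C A A" "v' \<in> Hom C A A"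
  shows "f \<Zcomp> u' = v' \<Zcomp> f"
proof -
  note [simp] = assms(4-)[THEN HomD(1)] assms(4-)[THEN HomD(2)] assms(4-)[THEN HomD(3)]
  have "f \<Zcomp> u' = (v' \<Zcomp> v) \<Zcomp> (f \<Zcomp> u')"
    unfolding assms(3) by simp
  also have "\<dots> = v' \<Zcomp> (f \<Zcomp> u) \<Zcomp> u'"
    unfolding assms(1) by simp
  also have "\<dots> = v' \<Zcomp> f"
    using assms(2) by simp
  finally show ?thesis .
qed

lemma isomorphism_K_if_Taylor:
  assumes A: "A \<in> Obj C" and Taylor: "Taylor C"
    and J: "isomorphism C (J C A)" and J1: "isomorphism C (Jn C 1 A)"
  shows "isomorphism C (K C A)"
proof -
  let ?i = "\<^bold>1 (\<^bold>!\<^sub>o A)" and ?j = "\<^bold>1 A" and ?z = "\<^bold>!\<^sub>a (\<^bold>0 A A)"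
  have ob: "\<^bold>!\<^sub>o A \<in> Obj C"
    using A by simp
  obtain L where L: "L \<in> Hom C (\<^bold>!\<^sub>o A) (\<^bold>!\<^sub>o A)" "J C A \<Zcomp> L = ?i" "L \<Zcomp> J C A = ?i"
    using isomorphism_inverse[OF ob J] A by (auto simp: Hom_def)
  obtain M where M: "M \<in> Hom C (\<^bold>!\<^sub>o A) (\<^bold>!\<^sub>o A)" "Jn C 1 A \<Zcomp> M = ?i" "M \<Zcomp> Jn C 1 A = ?i"
    using isomorphism_inverse[OF ob J1] A by (auto simp: Hom_def)
  note [simp] = HomD[OF L(1)] HomD[OF M(1)]
  \<comment> \<open>Inverting \<open>Deriv_J\<close> and \<open>J_coderiving\<close>: crossing
    \<open>d\<close> or \<open>d\<degree>\<close> exchanges \<open>L\<close>, which inverts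
    \<open>J\<close>, with \<open>M\<close>, which inverts J_1.\<close>
  have dL: "\<^bold>d A \<Zcomp> L = (M \<otimes>\<^sub>a ?j) \<Zcomp> \<^bold>d A"
    using A L M by (intro conjugate_inverse[OF Deriv_J[OF A]]) (simp_all add: Hom_def interchange)
  have Md: "\<^bold>d\<degree> A \<Zcomp> (M \<otimes>\<^sub>a ?j) = L \<Zcomp> \<^bold>d\<degree> A"
    using A L M by (intro conjugate_inverse[OF J_coderiving[OF A, symmetric]])
      (simp_all add: Hom_def interchange)
  \<comment> \<open>In degree k > 0, \<open>d\<degree>\<close> and \<open>d\<close> contribute the
    factor k and \<open>L\<close> divides by k; in degree zero \<open>?f\<close> vanishes.\<close>
  let ?f = "\<^bold>d\<degree> A \<Zcomp> (L \<otimes>\<^sub>a ?j) \<Zcomp> \<^bold>d A"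
  have "\<^bold>d A \<Zcomp> ?f = (\<^bold>d A \<Zcomp> \<^bold>d\<degree> A) \<Zcomp> ((L \<otimes>\<^sub>a ?j) \<Zcomp> \<^bold>d A)"
    using A by simp
  also have "\<dots> = (\<^bold>d\<degree> A \<otimes>\<^sub>a ?j) \<Zcomp> (?i \<otimes>\<^sub>a \<^bold>\<sigma> A A) \<Zcomp> ((\<^bold>d A \<Zcomp> L) \<otimes>\<^sub>a ?j) \<Zcomp> \<^bold>d A \<^bold>+ (L \<otimes>\<^sub>a ?j) \<Zcomp> \<^bold>d A"
    unfolding Deriv_coderiving[OF A]
    using A interchange[of "\<^bold>d A" L ?j ?j, THEN Comp_extend, of "\<^bold>d A"] by (simp add: Comp_Add_left)
  also have "(\<^bold>d A \<Zcomp> L) \<otimes>\<^sub>a ?j = (M \<otimes>\<^sub>a \<^bold>1 (A \<otimes>\<^sub>o A)) \<Zcomp> (\<^bold>d A \<otimes>\<^sub>a ?j)"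
    unfolding dL using A interchange[of "M \<otimes>\<^sub>a ?j" "\<^bold>d A" ?j ?j] by simp
  also have "(\<^bold>d\<degree> A \<otimes>\<^sub>a ?j) \<Zcomp> (?i \<otimes>\<^sub>a \<^bold>\<sigma> A A) \<Zcomp> ((M \<otimes>\<^sub>a \<^bold>1 (A \<otimes>\<^sub>o A)) \<Zcomp> (\<^bold>d A \<otimes>\<^sub>a ?j)) \<Zcomp> \<^bold>d A =
      (\<^bold>d\<degree> A \<otimes>\<^sub>a ?j) \<Zcomp> ((?i \<otimes>\<^sub>a \<^bold>\<sigma> A A) \<Zcomp> (M \<otimes>\<^sub>a \<^bold>1 (A \<otimes>\<^sub>o A))) \<Zcomp> ((\<^bold>d A \<otimes>\<^sub>a ?j) \<Zcomp> \<^bold>d A)"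
    using A by simp
  \<comment> \<open>\<open>M\<close> acts on \<open>!A\<close> and the symmetry on the two copies of
    \<open>A\<close>; once they are exchanged, [d.5] absorbs the symmetry.\<close>
  also have "(?i \<otimes>\<^sub>a \<^bold>\<sigma> A A) \<Zcomp> (M \<otimes>\<^sub>a \<^bold>1 (A \<otimes>\<^sub>o A)) = (M \<otimes>\<^sub>a \<^bold>1 (A \<otimes>\<^sub>o A)) \<Zcomp> (?i \<otimes>\<^sub>a \<^bold>\<sigma> A A)"
    using A by (simp add: interchange)
  also have "(\<^bold>d\<degree> A \<otimes>\<^sub>a ?j) \<Zcomp> ((M \<otimes>\<^sub>a \<^bold>1 (A \<otimes>\<^sub>o A)) \<Zcomp> (?i \<otimes>\<^sub>a \<^bold>\<sigma> A A)) \<Zcomp> ((\<^bold>d A \<otimes>\<^sub>a ?j) \<Zcomp> \<^bold>d A) =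
      ((\<^bold>d\<degree> A \<otimes>\<^sub>a ?j) \<Zcomp> (M \<otimes>\<^sub>a \<^bold>1 (A \<otimes>\<^sub>o A))) \<Zcomp> ((?i \<otimes>\<^sub>a \<^bold>\<sigma> A A) \<Zcomp> (\<^bold>d A \<otimes>\<^sub>a ?j) \<Zcomp> \<^bold>d A)"
    using A by simp
  also have "\<dots> = ((\<^bold>d\<degree> A \<Zcomp> (M \<otimes>\<^sub>a ?j)) \<otimes>\<^sub>a ?j) \<Zcomp> ((\<^bold>d A \<otimes>\<^sub>a ?j) \<Zcomp> \<^bold>d A)"
    unfolding d5[OF A, symmetric] using A interchange[of "\<^bold>d\<degree> A" "M \<otimes>\<^sub>a ?j" ?j ?j] by simp
  also have "\<dots> = ((L \<Zcomp> W A) \<otimes>\<^sub>a ?j) \<Zcomp> \<^bold>d A"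
    unfolding Md using A interchange[of "L \<Zcomp> \<^bold>d\<degree> A" "\<^bold>d A" ?j ?j, THEN Comp_extend, of "\<^bold>d A"]
    by (simp add: W_def)
  \<comment> \<open>The summands combine since \<open>W\<close> plus the identity is
    \<open>J\<close>, which \<open>L\<close> cancels.\<close>
  also have "\<dots> \<^bold>+ (L \<otimes>\<^sub>a ?j) \<Zcomp> \<^bold>d A = ((L \<Zcomp> J C A) \<otimes>\<^sub>a ?j) \<Zcomp> \<^bold>d A"
    using A by (simp add: J_eq Comp_Add_left Comp_Add_right Tensor_Add_left)
  finally have df: "\<^bold>d A \<Zcomp> ?f = \<^bold>d A"
    using A L by simp
  have zf: "?z \<Zcomp> ?f = \<^bold>0 (\<^bold>!\<^sub>o A) (\<^bold>!\<^sub>o A)"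
    using A Bang_Zero_coderiving[OF A, THEN Comp_extend, of "(L \<otimes>\<^sub>a ?j) \<Zcomp> \<^bold>d A"] by simp
  \<comment> \<open>\<open>?f\<close> and the identity have equal derivatives, so Taylor applies
    with the unit as context object.\<close>
  have "?f \<^bold>+ (\<^bold>1 \<^bold>I \<otimes>\<^sub>a ?z) \<Zcomp> ?i = ?i \<^bold>+ (\<^bold>1 \<^bold>I \<otimes>\<^sub>a ?z) \<Zcomp> ?f"
    using Taylor[unfolded Taylor_def, rule_format, of A "\<^bold>!\<^sub>o A" "\<^bold>I" ?f ?i] A df
    by (simp add: Hom_def)
  then have one: "?f \<^bold>+ ?z = ?i"
    using A zf by simp
  \<comment> \<open>With \<open>L\<close> twice the factor in degree k > 0 is 1/k, so
    \<open>?g\<close> inverts \<open>W\<close> there.\<close>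
  let ?g = "\<^bold>d\<degree> A \<Zcomp> (L \<otimes>\<^sub>a ?j) \<Zcomp> (L \<otimes>\<^sub>a ?j) \<Zcomp> \<^bold>d A"
  have JL: "(J C A \<otimes>\<^sub>a ?j) \<Zcomp> (L \<otimes>\<^sub>a ?j) = \<^bold>1 (\<^bold>!\<^sub>o A \<otimes>\<^sub>o A)"
    "(L \<otimes>\<^sub>a ?j) \<Zcomp> (J C A \<otimes>\<^sub>a ?j) = \<^bold>1 (\<^bold>!\<^sub>o A \<otimes>\<^sub>o A)"
    using A L by (simp_all add: interchange)
  have Wg: "W A \<Zcomp> ?g = ?f"
  proof -
    have "W A \<Zcomp> ?g = (W A \<Zcomp> \<^bold>d\<degree> A) \<Zcomp> ((L \<otimes>\<^sub>a ?j) \<Zcomp> (L \<otimes>\<^sub>a ?j) \<Zcomp> \<^bold>d A)"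
      using A by simp
    also have "\<dots> = \<^bold>d\<degree> A \<Zcomp> ((J C A \<otimes>\<^sub>a ?j) \<Zcomp> (L \<otimes>\<^sub>a ?j)) \<Zcomp> ((L \<otimes>\<^sub>a ?j) \<Zcomp> \<^bold>d A)"
      unfolding W_coderiving[OF A] using A by simp
    also have "\<dots> = ?f"
      unfolding JL using A by simp
    finally show ?thesis .
  qed
  have gW: "?g \<Zcomp> W A = ?f"
  proof -
    have "?g \<Zcomp> W A = \<^bold>d\<degree> A \<Zcomp> (L \<otimes>\<^sub>a ?j) \<Zcomp> (L \<otimes>\<^sub>a ?j) \<Zcomp> (\<^bold>d A \<Zcomp> W A)"
      using A by simp
    also have "\<dots> = \<^bold>d\<degree> A \<Zcomp> (L \<otimes>\<^sub>a ?j) \<Zcomp> ((L \<otimes>\<^sub>a ?j) \<Zcomp> (J C A \<otimes>\<^sub>a ?j)) \<Zcomp> \<^bold>d A"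
      unfolding Deriv_W[OF A] using A by simp
    also have "\<dots> = ?f"
      unfolding JL using A by simp
    finally show ?thesis .
  qed
  have gz: "?g \<Zcomp> ?z = \<^bold>0 (\<^bold>!\<^sub>o A) (\<^bold>!\<^sub>o A)"
    using A Deriv_Bang_Zero[OF A] by simp
  have zg: "?z \<Zcomp> ?g = \<^bold>0 (\<^bold>!\<^sub>o A) (\<^bold>!\<^sub>o A)"
    using A Bang_Zero_coderiving[OF A, THEN Comp_extend, of "(L \<otimes>\<^sub>a ?j) \<Zcomp> (L \<otimes>\<^sub>a ?j) \<Zcomp> \<^bold>d A"]
    by simp
  have Wz: "W A \<Zcomp> ?z = \<^bold>0 (\<^bold>!\<^sub>o A) (\<^bold>!\<^sub>o A)"
    using A Deriv_Bang_Zero[OF A] by (simp add: W_def)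
  have zW: "?z \<Zcomp> W A = \<^bold>0 (\<^bold>!\<^sub>o A) (\<^bold>!\<^sub>o A)"
    using A Bang_Zero_coderiving[OF A, THEN Comp_extend, of "\<^bold>d A"] by (simp add: W_def)
  have arr_g: "?g \<in> Arr C" "Dom C ?g = \<^bold>!\<^sub>o A" "Cod C ?g = \<^bold>!\<^sub>o A"
    using A by simp_all
  \<comment> \<open>The cross terms vanish and \<open>?z\<close> is idempotent, so the product is
    \<open>?f\<close> plus \<open>?z\<close>, the identity by \<open>one\<close>.\<close>
  have sum: "(w \<^bold>+ ?z) \<Zcomp> (g \<^bold>+ ?z) = ?i"
    if "w \<in> Arr C" "Dom C w = \<^bold>!\<^sub>o A" "Cod C w = \<^bold>!\<^sub>o A"
      "g \<in> Arr C" "Dom C g = \<^bold>!\<^sub>o A" "Cod C g = \<^bold>!\<^sub>o A"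
      "w \<Zcomp> g = ?f" "w \<Zcomp> ?z = \<^bold>0 (\<^bold>!\<^sub>o A) (\<^bold>!\<^sub>o A)" "?z \<Zcomp> g = \<^bold>0 (\<^bold>!\<^sub>o A) (\<^bold>!\<^sub>o A)" for w g
    using that A one by (simp add: Comp_Add_left Comp_Add_right Bang_Zero_idem)
  have "(W A \<^bold>+ ?z) \<Zcomp> (?g \<^bold>+ ?z) = ?i"
    by (rule sum[OF _ _ _ arr_g Wg Wz zg]) (use A in simp_all)
  moreover have "(?g \<^bold>+ ?z) \<Zcomp> (W A \<^bold>+ ?z) = ?i"
    by (rule sum[OF arr_g _ _ _ gW gz zW]) (use A in simp_all)
  moreover have "?g \<^bold>+ ?z \<in> Hom C (\<^bold>!\<^sub>o A) (\<^bold>!\<^sub>o A)"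
    using A arr_g by (simp add: Hom_def)
  ultimately show ?thesis
    using A unfolding isomorphism_def arr_K[OF A] by (auto simp: K_eq)
qed

lemma bang_natural_isomorphism_K_iff:
  "bang_natural_isomorphism C (K C) \<longleftrightarrow> (\<forall>A \<in> Obj C. isomorphism C (K C A))"
  by (simp add: natural_isomorphism_def natural_transformation_def Hom_def K_slide)

lemma bang_natural_isomorphism_Jn_iff:
  "bang_natural_isomorphism C (Jn C n) \<longleftrightarrow> (\<forall>A \<in> Obj C. isomorphism C (Jn C n A))"
  by (simp add: natural_isomorphism_def natural_transformation_def Hom_def Jn_slide)

lemma bang_natural_isomorphism_J_iff:
  "bang_natural_isomorphism C (J C) \<longleftrightarrow> (\<forall>A \<in> Obj C. isomorphism C (J C A))"
  using Jn_slide[where n = 0]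
  by (simp add: natural_isomorphism_def natural_transformation_def Hom_def Jn_0)

lemma isomorphism_J_if_K:
  assumes "\<And>A. A \<in> Obj C \<Longrightarrow> isomorphism C (K C A)" "A \<in> Obj C"
  shows "isomorphism C (J C A)"
  using isomorphism_Jn_by_shift[of A "K C (\<^bold>!\<^sub>o A)" 0] assms
  by (simp add: Hom_def inner_W_K K_coderiving Jn_0)

lemma isomorphism_Jn_Suc:
  assumes "\<And>A. A \<in> Obj C \<Longrightarrow> isomorphism C (Jn C n A)" "A \<in> Obj C"
  shows "isomorphism C (Jn C (Suc n) A)"
  using isomorphism_Jn_by_shift[of A "Jn C n (\<^bold>!\<^sub>o A)" "Suc n"] assms
  by (simp add: Hom_def inner_W_Jn Jn_coderiving)

lemma isomorphism_Jn_mono: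
  assumes "n \<le> m" "\<And>A. A \<in> Obj C \<Longrightarrow> isomorphism C (Jn C n A)" "A \<in> Obj C"
  shows "isomorphism C (Jn C m A)"
  using assms(1,3) by (induction m arbitrary: A rule: dec_induct) (auto intro: assms(2) isomorphism_Jn_Suc)

end

theorem proposition6p1:
  fixes C :: "('o, 'a, 'm) diff_category_scheme"
  assumes "differential_category C"
  shows "(bang_natural_isomorphism C (K C) \<longrightarrow> bang_natural_isomorphism C (J C)) \<and>
    (\<forall>n m. n \<le> m \<longrightarrow> bang_natural_isomorphism C (Jn C n) \<longrightarrow> bang_natural_isomorphism C (Jn C m)) \<and>
    (bang_natural_isomorphism C (J C) \<longrightarrow> Taylor C \<longrightarrow> bang_natural_isomorphism C (K C))"
proof -
  interpret differential_category C
    by fact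
  \<comment> \<open>The invertibility of J_1 that is required here comes from that of
    \<open>J\<close> by (ii), starting at n = 0.\<close>
  have "isomorphism C (K C A)"
    if "\<And>A. A \<in> Obj C \<Longrightarrow> isomorphism C (J C A)" "Taylor C" "A \<in> Obj C" for A
    using that isomorphism_Jn_Suc[of 0 A] by (intro isomorphism_K_if_Taylor) (simp_all add: Jn_0)
  then show ?thesis
    unfolding bang_natural_isomorphism_K_iff bang_natural_isomorphism_Jn_iff
      bang_natural_isomorphism_J_iff
    by (blast intro: isomorphism_J_if_K isomorphism_Jn_mono)
qed

end
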